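(* Consider an infinite run of the Algorithm described in the context. (i) Suppose the Noise, Matrix and Slack Assumptions hold. Then there exists $k\in\mathbb N$ such that $$\Delta\bar m_k(\bar d_k,\bar\tau_k)\le\max\left\{\frac{2\left(\eta_\phi E_k^{m,1}-(1-\eta_\phi)E_k^{m,2}\right)}{1-\eta_\phi},\ -2E_k^m,\ \frac{4(4+2\zeta)\varepsilon_k}{\hat\alpha_k\eta_\phi}\right\}.$$ (ii) Suppose that, in addition, the Rank and Jacobian-Noise Assumptions hold, and let $k_{\bar\tau},\bar\tau,\epsilon_d,\xi_d$ and $e_1^{m,1},e_2^{m,1},c_1^{m,2},c_2^{m,2}$ be as in the context. Then there exists $k\in\mathbb N$ with $k\ge k_{\bar\tau}$ such that $$\Delta\bar m_k(\bar d_k,\bar\tau)\le\max\{\rho_{k,1},\rho_{k,2},\rho_{k,3}\},$$ where $$\rho_{k,1}=2\left(\tfrac{\eta_\phi}{1-\eta_\phi}e_1^{m,1}+c_1^{m,2}+\xi_d^{-1/2}\left(\tfrac{\eta_\phi}{1-\eta_\phi}e_2^{m,1}+c_2^{m,2}\right)\Delta\bar m_k(\bar d_k,\bar\tau)^{1/2}\right),$$ $$\rho_{k,2}=2\left(e_1^{m,1}+c_1^{m,2}+\xi_d^{-1/2}\left(e_2^{m,1}+c_2^{m,2}\right)\Delta\bar m_k(\bar d_k,\bar\tau)^{1/2}\right),$$ $$\rho_{k,3}=\frac{4(4+2\zeta)\varepsilon_k}{\bar\alpha_k\eta_\phi}=\frac{4(4+2\zeta)\varepsilon_k}{\eta_\phi}\max\left\{\frac{4\xi_2(\tau_k)\left(\Delta\bar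 m_k(\bar d_k,\bar\tau)+\xi_d\epsilon_d^2\right)}{(1-\eta_\phi)\xi_d\,\Delta\bar m_k(\bar d_k,\bar\tau)},\frac{1}{\alpha_k^{\max}}\right\}.$$
   Context: Notation. $\|\cdot\|$ is the Euclidean norm or the induced spectral norm; vector inequalities are componentwise; $e$ is the all-ones vector; $S=\mathrm{diag}(s)$, $S_k=\mathrm{diag}(s_k)$; $\sigma_{\min}$ is the smallest singular value; $\mathbb N=\{0,1,2,\dots\}$. Barred symbols are exact (noiseless) quantities, unbarred ones are noisy. Problem functions. $\bar f_0:\mathbb R^n\to\mathbb R$, $\bar c_I:\mathbb R^n\to\mathbb R^q$, $\bar g_0=\nabla\bar f_0$, $\bar J_I$ is the Jacobian of $\bar c_I$, and $\mu>0$ is fixed. For $z=(x,s)\in\mathbb R^n\times\mathbb R^q$, $s>0$: $\bar f(z)=\bar f_0(x)-\mu\sum_{i=1}^q\log s^{(i)}$, $\bar c(z)=\bar c_I(x)+s$, $\bar g(z)=\begin{bmatrix}\bar g_0(x)\\ -\mu e\end{bmatrix}$, $\bar J(z)=[\bar J_I(x)\ \ S]$. Noisy functions $f_0,g_0,c_I,J_I$ approximate $\bar f_0,\bar g_0,\bar c_I,\bar J_I$, and $f,c,g,J$ are defined from them by the same formulas. For iterates $z_k=(x_k,s_k)$ write $f_k=f(z_k)$, $\bar f_k=\bar f(z_k)$, and similarly for $c,g,J$. Noise Assumption. The iterates $x_k$ lie in an open convex set $\mathcal X$ over which $\bar f_0,\bar c_I$ are continuously differentiable, $\bar f_0$ is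 bounded below, $\|\bar c_I(x)\|\le c_{I,\sup}$, $\|\bar g_0(x)\|\le g_{0,\sup}$, $\|\bar J_I(x)\|\le J_{I,\sup}$, and $\bar g_0,\bar J_I$ are Lipschitz continuous with constants $L_g,L_J\in(0,\infty)$. For known constants $\epsilon_f,\epsilon_g,\epsilon_c,\epsilon_J\in(0,\infty)$ and all $x\in\mathcal X$: $|\bar f_0(x)-f_0(x)|\le\epsilon_f$, $\|\bar g_0(x)-g_0(x)\|\le\epsilon_g$, $\|\bar c_I(x)-c_I(x)\|\le\epsilon_c$, $\|\bar J_I(x)-J_I(x)\|\le\epsilon_J$. Algorithm. Input: $(x_0,s_0,y_0)$ with $s_0>0$, $c(z_0)\ge0$; $\tau_{-1},\omega,\zeta\in(0,\infty)$; $\sigma,\delta_\tau,\eta_s,\eta_\phi\in(0,1)$. For $k=0,1,\dots$: 1. If $J_k^Tc_k=0$ and $c_I(x_k)\not\le0$, terminate. 2. $v_k$ solves $\min\{\tfrac12\|c_k+J_kv\|^2: v\in\mathrm{range}(J_k^T),\ \|v\|\le\omega\|J_k^Tc_k\|\}$. 3. Choose symmetric $W_k=\begin{bmatrix}H_k&0\\ 0&\Sigma_k\end{bmatrix}$ ($H_k\in\mathbb R^{n\times n}$; $\Sigma_k\in\mathbb R^{q\times q}$ diagonal positive definite) and solve $\begin{bmatrix}W_k&J_k^T\\ J_k&0\end{bmatrix}\begin{bmatrix}d_k\\ y_{k+1}\end{bmatrix}=\begin{bmatrix}-g_k\\ J_kv_k\end{bmatrix}$; write $d_k=(d_k^x,d_k^s)$,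 $u_k=d_k-v_k$. 4. If $J_k^Tc_k=0$ and $g_k+J_k^Ty_{k+1}=0$, terminate. 5. Set $\tau_k^{\rm trial}=\infty$ if $g_k^Td_k+\tfrac12u_k^TW_ku_k\le0$, and otherwise $\tau_k^{\rm trial}=\frac{(1-\sigma)(\|c_k\|-\|c_k+J_kv_k\|)}{g_k^Td_k+\frac12u_k^TW_ku_k}$. Set $\tau_k=\tau_{k-1}$ if $\tau_{k-1}\le\tau_k^{\rm trial}$, else $\tau_k=\min\{(1-\delta_\tau)\tau_{k-1},\tau_k^{\rm trial}\}$. 6. $\alpha_k^{\max}$ is the largest value in $(0,1]$ with $s_k+\alpha_k^{\max}S_kd_k^s\ge(1-\eta_s)s_k$. 7. With $\hat d_k=(d_k^x,S_kd_k^s)$, $\phi(z,\tau)=\tau f(z)+\|c(z)\|$, $\varepsilon_k=\tau_k\epsilon_f+\epsilon_c$, $\Delta m_k(d,\tau)=-\tau g_k^Td+\|c_k\|-\|c_k+J_kd\|$, set $\alpha_k=2^{-j}\alpha_k^{\max}$ for the smallest $j\in\mathbb N$ with $\phi(z_k+\alpha_k\hat d_k,\tau_k)\le\phi(z_k,\tau_k)-\eta_\phi\alpha_k\Delta m_k(d_k,\tau_k)+(2+\zeta)\varepsilon_k$. 8. $x_{k+1}=x_k+\alpha_kd_k^x$, $s_{k+1}=\max\{s_k+\alpha_kS_kd_k^s,-c_I(x_{k+1})\}$. Standing assumption: the Algorithm does not terminate finitely. Noiseless counterparts (at the same iterates $z_k$, with the same $W_k$). $\bar v_k$ solves the problem in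 step 2 with $(\bar c_k,\bar J_k)$; $(\bar d_k,\bar y_{k+1})$ solves the system in step 3 with $(\bar J_k,\bar g_k,\bar v_k)$; $\bar u_k=\bar d_k-\bar v_k$; $\{\bar\tau_k\}$ is generated by the rule in step 5 with all quantities replaced by noiseless ones, starting from $\bar\tau_{-1}=\tau_{-1}$; $\Delta\bar m_k(d,\tau)=-\tau\bar g_k^Td+\|\bar c_k\|-\|\bar c_k+\bar J_kd\|$. Errors: $\varepsilon_{c,k}=c_k-\bar c_k$, $\varepsilon_{g,k}=g_k-\bar g_k$, $\varepsilon_{J,k}=J_k-\bar J_k$, $\varepsilon_{d,k}=d_k-\bar d_k$, $\varepsilon_{\tau,k}=\tau_k-\bar\tau_k$. Matrix Assumption. (a) For all $k$, the system in step 3 and its noiseless counterpart each have a unique solution; (b) there is $\sigma_W>0$ with $p^TW_kp\ge\sigma_W\|p\|^2$ for all $k$ and all $p\in\mathrm{null}(J_k)\cup\mathrm{null}(\bar J_k)$; (c) there is $\kappa_W>0$ with $\|W_k\|\le\kappa_W$ for all $k$. Slack Assumption. There is $s_{\sup}\in(0,\infty)$ with $\|s_k\|\le s_{\sup}$ for all $k$. (Consequently there are $g_{\sup},J_{\sup}\in(0,\infty)$ with $\|\bar g_k\|\le g_{\sup}$, $\|\bar J_k\|\le J_{\sup}$ for all $k$.) Rank Assumption. There are $k_J\in\mathbb N$ and $\gamma\in(\epsilon_J,\infty)$ with $\sigma_{\min}(J_k)\ge\gamma$ for all $k\ge k_J$. Jacobian-Noise Assumption. Let $\lambda\ge0$ and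 $\sigma_\Gamma>0$ be constants such that, for all $k$, $\Gamma_k=W_k+\lambda J_k^TJ_k$ and $\bar\Gamma_k=W_k+\lambda\bar J_k^T\bar J_k$ are positive definite with smallest singular values at least $\sigma_\Gamma$ (such constants exist under the preceding assumptions). For all $k\ge k_J$, $$\|(\bar J_k\bar\Gamma_k^{-1}\bar J_k^T)^{-1}\|\left(\|\bar J_k\|\|\Gamma_k^{-1}J_k^T-\bar\Gamma_k^{-1}\bar J_k^T\|+\|\bar\Gamma_k^{-1}\bar J_k^T\|\epsilon_J+\|\Gamma_k^{-1}J_k^T-\bar\Gamma_k^{-1}\bar J_k^T\|\epsilon_J\right)<1.$$ Quantities in the claim. $E_k^{m,1}=-(\bar\tau_k+\varepsilon_{\tau,k})\varepsilon_{g,k}^T(\bar d_k+\varepsilon_{d,k})+\|\bar c_k+\varepsilon_{c,k}\|-\|\bar c_k\|-\left(\|\bar c_k+\bar J_k\bar d_k+\bar J_k\varepsilon_{d,k}+\varepsilon_{c,k}+\varepsilon_{J,k}\bar d_k+\varepsilon_{J,k}\varepsilon_{d,k}\|-\|\bar c_k+\bar J_k\bar d_k+\bar J_k\varepsilon_{d,k}\|\right)$; $E_k^{m,2}=-\bar\tau_k\bar g_k^T\varepsilon_{d,k}-\varepsilon_{\tau,k}\bar g_k^T\bar d_k-\varepsilon_{\tau,k}\bar g_k^T\varepsilon_{d,k}+\|\bar c_k+\bar J_k\bar d_k\|-\|\bar c_k+\bar J_k\bar d_k+\bar J_k\varepsilon_{d,k}\|$; $E_k^m=E_k^{m,1}+E_k^{m,2}$;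 $\xi_2(\tau)=\max\{\tfrac12(\tau L_g+L_J),\tfrac{\tau\mu}{1-\eta_s}\}$; $\hat\alpha_k=\min\left\{\frac{(1-\eta_\phi)\Delta\bar m_k(\bar d_k,\bar\tau_k)}{2\xi_2(\tau_k)\|\bar d_k+\varepsilon_{d,k}\|^2},\alpha_k^{\max}\right\}$. Under all five assumptions there exist, and we fix: $k_{\bar\tau}\in\mathbb N$ and $\bar\tau\in(0,\infty)$ with $\bar\tau_k=\bar\tau$ for all $k\ge k_{\bar\tau}$; $\epsilon_d\in[0,\infty)$ with $\|d_k-\bar d_k\|\le\epsilon_d$ for all $k\ge k_J$; $\xi_d\in(0,\infty)$ with $\xi_d\|\bar d_k\|^2\le\Delta\bar m_k(\bar d_k,\bar\tau_k)$ for all $k\in\mathbb N$. Further, $e_1^{m,1}=(\tau_{-1}\epsilon_g+\epsilon_J)\epsilon_d+2\epsilon_c$, $e_2^{m,1}=\tau_{-1}\epsilon_g+\epsilon_J$, $c_1^{m,2}=(\tau_{-1}g_{\sup}+J_{\sup})\epsilon_d$, $c_2^{m,2}=\tau_{-1}g_{\sup}$, and for $k\ge k_{\bar\tau}$, $\bar\alpha_k=\min\left\{\frac{(1-\eta_\phi)\xi_d\Delta\bar m_k(\bar d_k,\bar\tau_k)}{4\xi_2(\tau_k)(\Delta\bar m_k(\bar d_k,\bar\tau_k)+\xi_d\epsilon_d^2)},\alpha_k^{\max}\right\}$. A fraction with a positive numerator and zero denominator is read as $+\infty$.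
   Formalization: The Noise Assumption is strengthened: the set X must contain not only the iterates x_k but also every point x_k + 2^{-i} α_k^max d_k^x tried by the line search up to acceptance; without this the claim is false, since noisy functions are unconstrained at rejected trial points outside X. *)

theory Defs
  imports "HOL-Analysis.Analysis"
begin

section \<open>Vectors and matrices\<close>

text \<open>Vectors of \<open>R^n x R^q\<close> are indexed by the disjoint sum of the two index types, so that the
  norm of the stacked vector is the Euclidean norm and matrices can be formed blockwise.\<close>

definition stack :: "real^'n \<Rightarrow> real^'q \<Rightarrow> real^('n + 'q)" where
  "stack a b = (\<chi> j. case j of Inl i \<Rightarrow> a $ i | Inr i \<Rightarrow> b $ i)"

definition xpart :: "real^('n::finite + 'q::finite) \<Rightarrow> real^'n" where
  "xpart d = (\<chi> i. d $ Inl i)"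

definition spart :: "real^('n::finite + 'q::finite) \<Rightarrow> real^'q" where
  "spart d = (\<chi> i. d $ Inr i)"

definition diag :: "real^'q \<Rightarrow> real^'q^'q" where
  "diag s = (\<chi> i j. if i = j then s $ i else 0)"

text \<open>\<open>beside A B\<close> is the matrix \<open>[A B]\<close>; \<open>blockdiag A B\<close> has diagonal blocks \<open>A\<close> and \<open>B\<close>.\<close>

definition beside :: "real^'n^'m \<Rightarrow> real^'q^'m \<Rightarrow> real^('n + 'q)^'m" where
  "beside A B = (\<chi> i. stack (A $ i) (B $ i))"

definition blockdiag :: "real^'n^'n \<Rightarrow> real^'q^'q \<Rightarrow> real^('n + 'q)^('n + 'q)" where
  "blockdiag A B = (\<chi> i. case i of Inl a \<Rightarrow> stack (A $ a) 0 | Inr b \<Rightarrow> stack 0 (B $ b))"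

text \<open>The library's \<open>norm\<close> on matrices is the Frobenius norm, hence a separate spectral norm.\<close>

definition spec_norm :: "real^'b^'a \<Rightarrow> real" where
  "spec_norm A = onorm ((*v) A)"

definition eigvals :: "real^'a^'a \<Rightarrow> real set" where
  "eigvals A = {l. \<exists>u. u \<noteq> 0 \<and> A *v u = l *\<^sub>R u}"

text \<open>An \<open>m x n\<close> matrix has \<open>min m n\<close> singular values: the square roots of the eigenvalues of the
  smaller of its two Gram matrices.\<close>

definition sigma_min :: "real^'b^'a \<Rightarrow> real" where
  "sigma_min A = sqrt (if CARD('a) \<le> CARD('b) then Min (eigvals (A ** transpose A))
                       else Min (eigvals (transpose A ** A)))"

definition pos_def :: "real^'a^'a \<Rightarrow> bool" where
  "pos_def A \<longleftrightarrow> transpose A = A \<and> (\<forall>p. p \<noteq> 0 \<longrightarrow> 0 < p \<bullet> (A *v p))"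

definition null_sp :: "real^'b^'a \<Rightarrow> (real^'b) set" where
  "null_sp A = {p. A *v p = 0}"

section \<open>Problem functions\<close>

text \<open>The same record type holds the exact data (objective, its gradient, inequality constraint
  function, its Jacobian) and the noisy approximations of these four functions.\<close>

record ('n::finite, 'q::finite) model =
  obj :: "real^'n \<Rightarrow> real"
  grad :: "real^'n \<Rightarrow> real^'n"
  con :: "real^'n \<Rightarrow> real^'q"
  jac :: "real^'n \<Rightarrow> real^'n^'q"

text \<open>\<open>tau_init\<close> is the parameter with index -1; \<open>sigma_tau\<close> and \<open>delta_tau\<close> are the constants
  \<open>\<sigma>\<close> and \<open>\<delta>\<^sub>\<tau>\<close> of the merit parameter update.\<close>

record params =
  mu :: real
  tau_init :: real
  omega :: real
  zeta :: real
  sigma_tau :: real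
  delta_tau :: real
  eta_s :: real
  eta_phi :: real
  eps_f :: real
  eps_g :: real
  eps_c :: real
  eps_J :: real

definition valid_params :: "params \<Rightarrow> bool" where
  "valid_params c \<longleftrightarrow> 0 < mu c \<and> 0 < tau_init c \<and> 0 < omega c \<and> 0 < zeta c
     \<and> 0 < sigma_tau c \<and> sigma_tau c < 1 \<and> 0 < delta_tau c \<and> delta_tau c < 1
     \<and> 0 < eta_s c \<and> eta_s c < 1 \<and> 0 < eta_phi c \<and> eta_phi c < 1
     \<and> 0 < eps_f c \<and> 0 < eps_g c \<and> 0 < eps_c c \<and> 0 < eps_J c"

definition barf :: "('n::finite, 'q::finite) model \<Rightarrow> params \<Rightarrow> real^'n \<Rightarrow> real^'q \<Rightarrow> real" where
  "barf M c x s = obj M x - mu c * (\<Sum>i\<in>UNIV. ln (s $ i))"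

definition barc :: "('n::finite, 'q::finite) model \<Rightarrow> real^'n \<Rightarrow> real^'q \<Rightarrow> real^'q" where
  "barc M x s = con M x + s"

definition barg :: "('n::finite, 'q::finite) model \<Rightarrow> params \<Rightarrow> real^'n \<Rightarrow> real^('n + 'q)" where
  "barg M c x = stack (grad M x) (\<chi> i. - mu c)"

definition barJ :: "('n::finite, 'q::finite) model \<Rightarrow> real^'n \<Rightarrow> real^'q \<Rightarrow> real^('n + 'q)^'q" where
  "barJ M x s = beside (jac M x) (diag s)"

definition merit :: "('n::finite, 'q::finite) model \<Rightarrow> params \<Rightarrow> real^'n \<Rightarrow> real^'q \<Rightarrow> real \<Rightarrow> real" where
  "merit M c x s \<tau> = \<tau> * barf M c x s + norm (barc M x s)"

section \<open>The algorithm\<close>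

text \<open>\<open>iterates\<close> collects what the noisy run and its noiseless counterpart share; \<open>steps\<close> collects
  what is computed separately from noisy and from exact data. In \<open>steps\<close>, \<open>mult (Suc k)\<close> is the
  multiplier obtained in iteration \<open>k\<close>, and \<open>mult 0\<close> is the input \<open>y\<^sub>0\<close>.\<close>

record ('n::finite, 'q::finite) iterates =
  itx :: "nat \<Rightarrow> real^'n"
  its :: "nat \<Rightarrow> real^'q"
  itH :: "nat \<Rightarrow> real^'n^'n"
  itSig :: "nat \<Rightarrow> real^'q^'q"
  amax :: "nat \<Rightarrow> real"
  alph :: "nat \<Rightarrow> real"

record ('n::finite, 'q::finite) steps =
  nstep :: "nat \<Rightarrow> real^('n + 'q)"
  dir :: "nat \<Rightarrow> real^('n + 'q)"
  mult :: "nat \<Rightarrow> real^'q"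
  mpar :: "nat \<Rightarrow> real"

definition gk :: "('n::finite, 'q::finite) model \<Rightarrow> params \<Rightarrow> ('n, 'q) iterates \<Rightarrow> nat \<Rightarrow> real^('n + 'q)" where
  "gk M c it k = barg M c (itx it k)"

definition ck :: "('n::finite, 'q::finite) model \<Rightarrow> ('n, 'q) iterates \<Rightarrow> nat \<Rightarrow> real^'q" where
  "ck M it k = barc M (itx it k) (its it k)"

definition Jk :: "('n::finite, 'q::finite) model \<Rightarrow> ('n, 'q) iterates \<Rightarrow> nat \<Rightarrow> real^('n + 'q)^'q" where
  "Jk M it k = barJ M (itx it k) (its it k)"

definition Wk :: "('n::finite, 'q::finite) iterates \<Rightarrow> nat \<Rightarrow> real^('n + 'q)^('n + 'q)" where
  "Wk it k = blockdiag (itH it k) (itSig it k)"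

definition normal_step :: "real \<Rightarrow> real^'a \<Rightarrow> real^'b^'a \<Rightarrow> real^'b \<Rightarrow> bool" where
  "normal_step w cv J v \<longleftrightarrow>
     is_arg_min (\<lambda>v. 1/2 * (norm (cv + J *v v))^2)
       (\<lambda>v. v \<in> range ((*v) (transpose J)) \<and> norm v \<le> w * norm (transpose J *v cv)) v"

definition kkt_system ::
  "real^'b^'b \<Rightarrow> real^'b^'a \<Rightarrow> real^'b \<Rightarrow> real^'b \<Rightarrow> real^'b \<Rightarrow> real^'a \<Rightarrow> bool" where
  "kkt_system W J g v d y \<longleftrightarrow> W *v d + transpose J *v y = - g \<and> J *v d = J *v v"

definition tau_trial ::
  "params \<Rightarrow> real^'b^'b \<Rightarrow> real^'b \<Rightarrow> real^'a \<Rightarrow> real^'b^'a \<Rightarrow> real^'b \<Rightarrow> real^'b \<Rightarrow> ereal" where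
  "tau_trial c W g cv J v d =
     (let u = d - v; m = g \<bullet> d + 1/2 * (u \<bullet> (W *v u))
      in if m \<le> 0 then \<infinity>
         else ereal ((1 - sigma_tau c) * (norm cv - norm (cv + J *v v)) / m))"

definition tau_update :: "params \<Rightarrow> real \<Rightarrow> ereal \<Rightarrow> ereal" where
  "tau_update c t trial =
     (if ereal t \<le> trial then ereal t else min (ereal ((1 - delta_tau c) * t)) trial)"

definition prev_tau :: "params \<Rightarrow> (nat \<Rightarrow> real) \<Rightarrow> nat \<Rightarrow> real" where
  "prev_tau c t k = (case k of 0 \<Rightarrow> tau_init c | Suc j \<Rightarrow> t j)"

text \<open>Normal step, search direction and merit parameter computed at the iterates \<open>it\<close> from the
  data \<open>M\<close>.\<close>

definition steps_from ::
  "('n::finite, 'q::finite) model \<Rightarrow> params \<Rightarrow> ('n, 'q) iterates \<Rightarrow> ('n, 'q) steps \<Rightarrow> bool" where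
  "steps_from M c it st \<longleftrightarrow> (\<forall>k.
     normal_step (omega c) (ck M it k) (Jk M it k) (nstep st k)
     \<and> kkt_system (Wk it k) (Jk M it k) (gk M c it k) (nstep st k) (dir st k) (mult st (Suc k))
     \<and> ereal (mpar st k) = tau_update c (prev_tau c (mpar st) k)
         (tau_trial c (Wk it k) (gk M c it k) (ck M it k) (Jk M it k) (nstep st k) (dir st k)))"

definition delta_m ::
  "('n::finite, 'q::finite) model \<Rightarrow> params \<Rightarrow> ('n, 'q) iterates \<Rightarrow> nat \<Rightarrow> real^('n + 'q) \<Rightarrow> real \<Rightarrow> real" where
  "delta_m M c it k d \<tau> =
     - \<tau> * (gk M c it k \<bullet> d) + norm (ck M it k) - norm (ck M it k + Jk M it k *v d)"

definition eps_k :: "params \<Rightarrow> ('n::finite, 'q::finite) steps \<Rightarrow> nat \<Rightarrow> real" where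
  "eps_k c st k = mpar st k * eps_f c + eps_c c"

definition sdir :: "('n::finite, 'q::finite) iterates \<Rightarrow> ('n, 'q) steps \<Rightarrow> nat \<Rightarrow> real^'q" where
  "sdir it st k = diag (its it k) *v spart (dir st k)"

definition max_stepsize ::
  "params \<Rightarrow> ('n::finite, 'q::finite) iterates \<Rightarrow> ('n, 'q) steps \<Rightarrow> nat \<Rightarrow> bool" where
  "max_stepsize c it st k \<longleftrightarrow>
     (let A = {a. 0 < a \<and> a \<le> 1 \<and> its it k + a *\<^sub>R sdir it st k \<ge> (1 - eta_s c) *\<^sub>R its it k}
      in amax it k \<in> A \<and> (\<forall>a\<in>A. a \<le> amax it k))"

definition sufficient_decrease ::
  "('n::finite, 'q::finite) model \<Rightarrow> params \<Rightarrow> ('n, 'q) iterates \<Rightarrow> ('n, 'q) steps \<Rightarrow> nat \<Rightarrow> real \<Rightarrow> bool" where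
  "sufficient_decrease M c it st k a \<longleftrightarrow>
     merit M c (itx it k + a *\<^sub>R xpart (dir st k)) (its it k + a *\<^sub>R sdir it st k) (mpar st k)
       \<le> merit M c (itx it k) (its it k) (mpar st k)
          - eta_phi c * a * delta_m M c it k (dir st k) (mpar st k)
          + (2 + zeta c) * eps_k c st k"

definition backtracking ::
  "('n::finite, 'q::finite) model \<Rightarrow> params \<Rightarrow> ('n, 'q) iterates \<Rightarrow> ('n, 'q) steps \<Rightarrow> nat \<Rightarrow> bool" where
  "backtracking M c it st k \<longleftrightarrow>
     (\<exists>j. sufficient_decrease M c it st k (amax it k / 2^j)
        \<and> (\<forall>i<j. \<not> sufficient_decrease M c it st k (amax it k / 2^i))
        \<and> alph it k = amax it k / 2^j)"

text \<open>An infinite run of the algorithm on the noisy data \<open>M\<close>: neither termination test ever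
  succeeds. Strict inequality of vectors is written out, since the library's \<open><\<close> on
  vectors is not the componentwise one.\<close>

definition infinite_run ::
  "('n::finite, 'q::finite) model \<Rightarrow> params \<Rightarrow> ('n, 'q) iterates \<Rightarrow> ('n, 'q) steps \<Rightarrow> bool" where
  "infinite_run M c it st \<longleftrightarrow>
     valid_params c
     \<and> (\<forall>i. 0 < its it 0 $ i) \<and> 0 \<le> ck M it 0
     \<and> steps_from M c it st
     \<and> (\<forall>k.
          \<not> (transpose (Jk M it k) *v ck M it k = 0 \<and> \<not> con M (itx it k) \<le> 0)
        \<and> transpose (itH it k) = itH it k
        \<and> (\<forall>i j. i \<noteq> j \<longrightarrow> itSig it k $ i $ j = 0) \<and> pos_def (itSig it k)
        \<and> \<not> (transpose (Jk M it k) *v ck M it k = 0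
             \<and> gk M c it k + transpose (Jk M it k) *v mult st (Suc k) = 0)
        \<and> max_stepsize c it st k
        \<and> backtracking M c it st k
        \<and> itx it (Suc k) = itx it k + alph it k *\<^sub>R xpart (dir st k)
        \<and> its it (Suc k) = (\<chi> i. max ((its it k + alph it k *\<^sub>R sdir it st k) $ i)
                                     (- con M (itx it (Suc k)) $ i)))"

section \<open>Assumptions\<close>

text \<open>In the assumptions and below, \<open>M\<close>, \<open>st\<close> are the noisy data and quantities, and \<open>N\<close>, \<open>sb\<close> are
  the exact data and the noiseless counterparts.

  The set \<open>X\<close> is required to contain all points at which the run evaluates the problem functions,
  i.e. the iterates and the points tried by the backtracking loop up to the accepted one. Nothing
  can be said about rejected trial points otherwise: with \<open>X = (-1,1)\<close>, \<open>f\<^sub>0(x) = -x\<close> on \<open>X\<close> and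
  \<open>f\<^sub>0\<close> huge outside \<open>X\<close>, the step sizes would be governed by the distance to the boundary of \<open>X\<close>.\<close>

definition noise_assumption ::
  "('n::finite, 'q::finite) model \<Rightarrow> ('n, 'q) model \<Rightarrow> params \<Rightarrow> ('n, 'q) iterates \<Rightarrow> ('n, 'q) steps
     \<Rightarrow> (real^'n) set \<Rightarrow> real \<Rightarrow> real \<Rightarrow> bool" where
  "noise_assumption M N c it st X Lg LJ \<longleftrightarrow>
     open X \<and> convex X
     \<and> (\<forall>k. itx it k \<in> X)
     \<and> (\<forall>k j. alph it k \<le> amax it k / 2^j \<longrightarrow>
          itx it k + (amax it k / 2^j) *\<^sub>R xpart (dir st k) \<in> X)
     \<and> (\<forall>x\<in>X. GDERIV (obj N) x :> grad N x) \<and> continuous_on X (grad N)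
     \<and> (\<forall>x\<in>X. (con N has_derivative (*v) (jac N x)) (at x)) \<and> continuous_on X (jac N)
     \<and> bdd_below (obj N ` X)
     \<and> (\<exists>c_sup. \<forall>x\<in>X. norm (con N x) \<le> c_sup)
     \<and> (\<exists>g0_sup. \<forall>x\<in>X. norm (grad N x) \<le> g0_sup)
     \<and> (\<exists>JI_sup. \<forall>x\<in>X. spec_norm (jac N x) \<le> JI_sup)
     \<and> 0 < Lg \<and> (\<forall>x\<in>X. \<forall>y\<in>X. norm (grad N x - grad N y) \<le> Lg * norm (x - y))
     \<and> 0 < LJ \<and> (\<forall>x\<in>X. \<forall>y\<in>X. spec_norm (jac N x - jac N y) \<le> LJ * norm (x - y))
     \<and> (\<forall>x\<in>X. \<bar>obj N x - obj M x\<bar> \<le> eps_f c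
            \<and> norm (grad N x - grad M x) \<le> eps_g c
            \<and> norm (con N x - con M x) \<le> eps_c c
            \<and> spec_norm (jac N x - jac M x) \<le> eps_J c)"

definition matrix_assumption ::
  "('n::finite, 'q::finite) model \<Rightarrow> ('n, 'q) model \<Rightarrow> params \<Rightarrow> ('n, 'q) iterates
     \<Rightarrow> ('n, 'q) steps \<Rightarrow> ('n, 'q) steps \<Rightarrow> bool" where
  "matrix_assumption M N c it st sb \<longleftrightarrow>
     (\<forall>k. (\<exists>!p. kkt_system (Wk it k) (Jk M it k) (gk M c it k) (nstep st k) (fst p) (snd p))
        \<and> (\<exists>!p. kkt_system (Wk it k) (Jk N it k) (gk N c it k) (nstep sb k) (fst p) (snd p)))
     \<and> (\<exists>sigW>0. \<forall>k. \<forall>p \<in> null_sp (Jk M it k) \<union> null_sp (Jk N it k).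
          sigW * (norm p)^2 \<le> p \<bullet> (Wk it k *v p))
     \<and> (\<exists>kapW>0. \<forall>k. spec_norm (Wk it k) \<le> kapW)"

definition slack_assumption :: "('n::finite, 'q::finite) iterates \<Rightarrow> bool" where
  "slack_assumption it \<longleftrightarrow> (\<exists>s_sup>0. \<forall>k. norm (its it k) \<le> s_sup)"

definition rank_assumption ::
  "('n::finite, 'q::finite) model \<Rightarrow> params \<Rightarrow> ('n, 'q) iterates \<Rightarrow> nat \<Rightarrow> real \<Rightarrow> bool" where
  "rank_assumption M c it kJ \<gamma> \<longleftrightarrow> eps_J c < \<gamma> \<and> (\<forall>k\<ge>kJ. \<gamma> \<le> sigma_min (Jk M it k))"

definition Gam ::
  "('n::finite, 'q::finite) model \<Rightarrow> ('n, 'q) iterates \<Rightarrow> real \<Rightarrow> nat \<Rightarrow> real^('n + 'q)^('n + 'q)" where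
  "Gam M it l k = Wk it k + l *\<^sub>R (transpose (Jk M it k) ** Jk M it k)"

definition GamJ ::
  "('n::finite, 'q::finite) model \<Rightarrow> ('n, 'q) iterates \<Rightarrow> real \<Rightarrow> nat \<Rightarrow> real^'q^('n + 'q)" where
  "GamJ M it l k = matrix_inv (Gam M it l k) ** transpose (Jk M it k)"

definition jacobian_noise_assumption ::
  "('n::finite, 'q::finite) model \<Rightarrow> ('n, 'q) model \<Rightarrow> params \<Rightarrow> ('n, 'q) iterates
     \<Rightarrow> nat \<Rightarrow> real \<Rightarrow> real \<Rightarrow> bool" where
  "jacobian_noise_assumption M N c it kJ l sG \<longleftrightarrow>
     0 \<le> l \<and> 0 < sG
     \<and> (\<forall>k. pos_def (Gam M it l k) \<and> pos_def (Gam N it l k)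
          \<and> sG \<le> sigma_min (Gam M it l k) \<and> sG \<le> sigma_min (Gam N it l k))
     \<and> (\<forall>k\<ge>kJ. spec_norm (matrix_inv (Jk N it k ** GamJ N it l k))
          * (spec_norm (Jk N it k) * spec_norm (GamJ M it l k - GamJ N it l k)
             + spec_norm (GamJ N it l k) * eps_J c
             + spec_norm (GamJ M it l k - GamJ N it l k) * eps_J c) < 1)"

section \<open>Quantities in the claim\<close>

definition E_m1 ::
  "('n::finite, 'q::finite) model \<Rightarrow> ('n, 'q) model \<Rightarrow> params \<Rightarrow> ('n, 'q) iterates
     \<Rightarrow> ('n, 'q) steps \<Rightarrow> ('n, 'q) steps \<Rightarrow> nat \<Rightarrow> real" where
  "E_m1 M N c it st sb k =
     (let cb = ck N it k; Jb = Jk N it k; db = dir sb k; tb = mpar sb k;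
          ec = ck M it k - cb; eg = gk M c it k - gk N c it k; eJ = Jk M it k - Jb;
          ed = dir st k - db; et = mpar st k - tb
      in - (tb + et) * (eg \<bullet> (db + ed)) + norm (cb + ec) - norm cb
         - (norm (cb + Jb *v db + Jb *v ed + ec + eJ *v db + eJ *v ed)
            - norm (cb + Jb *v db + Jb *v ed)))"

definition E_m2 ::
  "('n::finite, 'q::finite) model \<Rightarrow> params \<Rightarrow> ('n, 'q) iterates
     \<Rightarrow> ('n, 'q) steps \<Rightarrow> ('n, 'q) steps \<Rightarrow> nat \<Rightarrow> real" where
  "E_m2 N c it st sb k =
     (let cb = ck N it k; Jb = Jk N it k; gb = gk N c it k; db = dir sb k; tb = mpar sb k;
          ed = dir st k - db; et = mpar st k - tb
      in - tb * (gb \<bullet> ed) - et * (gb \<bullet> db) - et * (gb \<bullet> ed)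
         + norm (cb + Jb *v db) - norm (cb + Jb *v db + Jb *v ed))"

definition E_m ::
  "('n::finite, 'q::finite) model \<Rightarrow> ('n, 'q) model \<Rightarrow> params \<Rightarrow> ('n, 'q) iterates
     \<Rightarrow> ('n, 'q) steps \<Rightarrow> ('n, 'q) steps \<Rightarrow> nat \<Rightarrow> real" where
  "E_m M N c it st sb k = E_m1 M N c it st sb k + E_m2 N c it st sb k"

definition xi2 :: "params \<Rightarrow> real \<Rightarrow> real \<Rightarrow> real \<Rightarrow> real" where
  "xi2 c Lg LJ \<tau> = max (1/2 * (\<tau> * Lg + LJ)) (\<tau> * mu c / (1 - eta_s c))"

text \<open>Fractions whose denominator may vanish are taken in the extended reals, where
  \<open>a / 0 = \<infinity>\<close> for \<open>a > 0\<close> (and \<open>0 / 0 = 0\<close>).\<close>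

definition alpha_hat ::
  "('n::finite, 'q::finite) model \<Rightarrow> params \<Rightarrow> real \<Rightarrow> real \<Rightarrow> ('n, 'q) iterates
     \<Rightarrow> ('n, 'q) steps \<Rightarrow> ('n, 'q) steps \<Rightarrow> nat \<Rightarrow> ereal" where
  "alpha_hat N c Lg LJ it st sb k =
     (let db = dir sb k; ed = dir st k - db
      in min (ereal ((1 - eta_phi c) * delta_m N c it k db (mpar sb k))
                / ereal (2 * xi2 c Lg LJ (mpar st k) * (norm (db + ed))^2))
             (ereal (amax it k)))"

definition alpha_bar ::
  "('n::finite, 'q::finite) model \<Rightarrow> params \<Rightarrow> real \<Rightarrow> real \<Rightarrow> ('n, 'q) iterates
     \<Rightarrow> ('n, 'q) steps \<Rightarrow> ('n, 'q) steps \<Rightarrow> real \<Rightarrow> real \<Rightarrow> nat \<Rightarrow> ereal" where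
  "alpha_bar N c Lg LJ it st sb ed xd k =
     (let D = delta_m N c it k (dir sb k) (mpar sb k)
      in min (ereal ((1 - eta_phi c) * xd * D)
                / ereal (4 * xi2 c Lg LJ (mpar st k) * (D + xd * ed^2)))
             (ereal (amax it k)))"

definition e1_m1 :: "params \<Rightarrow> real \<Rightarrow> real" where
  "e1_m1 c ed = (tau_init c * eps_g c + eps_J c) * ed + 2 * eps_c c"

definition e2_m1 :: "params \<Rightarrow> real" where
  "e2_m1 c = tau_init c * eps_g c + eps_J c"

definition c1_m2 :: "params \<Rightarrow> real \<Rightarrow> real \<Rightarrow> real \<Rightarrow> real" where
  "c1_m2 c g_sup J_sup ed = (tau_init c * g_sup + J_sup) * ed"

definition c2_m2 :: "params \<Rightarrow> real \<Rightarrow> real" where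
  "c2_m2 c g_sup = tau_init c * g_sup"

text \<open>In the following, \<open>D\<close> stands for the noiseless model reduction at iteration \<open>k\<close>.\<close>

definition rho1 :: "params \<Rightarrow> real \<Rightarrow> real \<Rightarrow> real \<Rightarrow> real \<Rightarrow> real \<Rightarrow> real" where
  "rho1 c g_sup J_sup ed xd D =
     2 * (eta_phi c / (1 - eta_phi c) * e1_m1 c ed + c1_m2 c g_sup J_sup ed
          + xd powr (- 1/2) * (eta_phi c / (1 - eta_phi c) * e2_m1 c + c2_m2 c g_sup) * D powr (1/2))"

definition rho2 :: "params \<Rightarrow> real \<Rightarrow> real \<Rightarrow> real \<Rightarrow> real \<Rightarrow> real \<Rightarrow> real" where
  "rho2 c g_sup J_sup ed xd D =
     2 * (e1_m1 c ed + c1_m2 c g_sup J_sup ed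
          + xd powr (- 1/2) * (e2_m1 c + c2_m2 c g_sup) * D powr (1/2))"

definition rho3 ::
  "('n::finite, 'q::finite) model \<Rightarrow> params \<Rightarrow> real \<Rightarrow> real \<Rightarrow> ('n, 'q) iterates
     \<Rightarrow> ('n, 'q) steps \<Rightarrow> ('n, 'q) steps \<Rightarrow> real \<Rightarrow> real \<Rightarrow> nat \<Rightarrow> ereal" where
  "rho3 N c Lg LJ it st sb ed xd k =
     ereal (4 * (4 + 2 * zeta c) * eps_k c st k)
       / (alpha_bar N c Lg LJ it st sb ed xd k * ereal (eta_phi c))"

definition rho3_expanded ::
  "params \<Rightarrow> real \<Rightarrow> real \<Rightarrow> ('n::finite, 'q::finite) iterates \<Rightarrow> ('n, 'q) steps
     \<Rightarrow> real \<Rightarrow> real \<Rightarrow> real \<Rightarrow> nat \<Rightarrow> ereal" where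
  "rho3_expanded c Lg LJ it st ed xd D k =
     ereal (4 * (4 + 2 * zeta c) * eps_k c st k / eta_phi c)
       * max (ereal (4 * xi2 c Lg LJ (mpar st k) * (D + xd * ed^2))
                / ereal ((1 - eta_phi c) * xd * D))
             (ereal (1 / amax it k))"

end

theory Submission
  imports Defs
begin

text \<open>The noisy and the noiseless model reduction differ by \<open>E\<^sub>k\<^sup>m\<close>. While the noiseless one
  exceeds the first term of the maximum, a Taylor estimate of the exact merit function shows that
  every step size up to \<open>\<alpha>\<close>-hat passes the relaxed line search test, so the accepted step size is at
  least half of it; while it exceeds the second term, the noisy model reduction is at least half of
  the noiseless one; and while it exceeds the third, the merit function therefore drops by at least
  \<open>(2 + \<zeta>) \<epsilon>\<^sub>k\<close>, the relaxation included. As \<open>\<epsilon>\<^sub>k\<close> is bounded away from zero and the merit function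
  is bounded below, this cannot go on forever. Hence the bound holds for infinitely many \<open>k\<close>, and
  for (ii) it remains to estimate its three terms at such a \<open>k\<close> beyond \<open>k\<^sub>\<tau>\<close> and \<open>k\<^sub>J\<close>.\<close>

section \<open>Block vectors and matrices\<close>

lemma sum_UNIV_Plus:
  fixes h :: "('a::finite + 'b::finite) \<Rightarrow> 'c::comm_monoid_add"
  shows "(\<Sum>j\<in>UNIV. h j) = (\<Sum>i\<in>UNIV. h (Inl i)) + (\<Sum>i\<in>UNIV. h (Inr i))"
  by (simp add: UNIV_Plus_UNIV[symmetric] sum.Plus del: UNIV_Plus_UNIV)

lemma inner_stack: "stack a b \<bullet> d = a \<bullet> xpart d + b \<bullet> spart d"
  by (simp add: inner_vec_def sum_UNIV_Plus stack_def xpart_def spart_def)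

lemma norm_xpart_spart: "(norm d)\<^sup>2 = (norm (xpart d))\<^sup>2 + (norm (spart d))\<^sup>2"
  by (simp only: power2_norm_eq_inner)
    (simp add: inner_vec_def sum_UNIV_Plus xpart_def spart_def)

lemma norm_xpart_le: "norm (xpart d) \<le> norm d"
  by (rule power2_le_imp_le) (simp_all add: norm_xpart_spart)

lemma norm_stack_0: "norm (stack a (0 :: real^'q::finite)) = norm (a :: real^'n::finite)"
proof -
  have "xpart (stack a (0 :: real^'q)) = a" "spart (stack a (0 :: real^'q)) = 0"
    by (simp_all add: xpart_def spart_def stack_def vec_eq_iff)
  then show ?thesis
    using norm_xpart_spart[of "stack a (0 :: real^'q)"]
    by (simp add: power2_eq_iff_nonneg)
qed

lemma beside_mult: "beside A B *v d = A *v xpart d + B *v spart d"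
  by (simp add: vec_eq_iff beside_def matrix_vector_mult_def sum_UNIV_Plus stack_def
      xpart_def spart_def)

lemma diag_mult: "(diag s *v p) $ i = s $ i * p $ i"
  by (simp add: matrix_vector_mult_def diag_def if_distrib if_distribR sum.delta cong: if_cong)

lemma spec_norm_bound: "norm (A *v x) \<le> spec_norm A * norm x"
  unfolding spec_norm_def by (rule onorm[OF matrix_vector_mul_bounded_linear])

text \<open>Both matrices share the second block, which cancels in the difference. For the full
  Jacobians this block is \<open>diag s\<close>, so the noise bound for \<open>jac\<close> carries
  over unchanged.\<close>

lemma spec_norm_beside_diff: "norm ((beside A B - beside A' B) *v d) \<le> spec_norm (A - A') * norm d"
proof -
  have "norm ((beside A B - beside A' B) *v d) = norm ((A - A') *v xpart d)"
    by (simp add: matrix_vector_mult_diff_rdistrib beside_mult)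
  also have "\<dots> \<le> spec_norm (A - A') * norm (xpart d)"
    by (rule spec_norm_bound)
  also have "\<dots> \<le> spec_norm (A - A') * norm d"
    using norm_xpart_le[of d] unfolding spec_norm_def
    by (intro mult_left_mono onorm_pos_le[OF matrix_vector_mul_bounded_linear])
  finally show ?thesis .
qed

lemma stack_diff: "stack a b - stack a' b = stack (a - a') 0"
  by (simp add: vec_eq_iff stack_def split: sum.split)

text \<open>The reading of such fractions as infinite is used for a vanishing search direction and
  for a vanishing model reduction.\<close>

lemma ereal_pos_divide_zero: "0 < a \<Longrightarrow> ereal a / 0 = \<infinity>"
  by (simp add: divide_ereal_def)

section \<open>Quadratic upper bounds\<close>

text \<open>Subtracting the quadratic majorant from \<open>h\<close> leaves a function with
  nonpositive derivative on the unit interval.\<close>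

lemma quadratic_upper_bound:
  fixes h h' :: "real \<Rightarrow> real"
  assumes der: "\<And>t. 0 \<le> t \<Longrightarrow> t \<le> 1 \<Longrightarrow> (h has_real_derivative h' t) (at t)"
    and lip: "\<And>t. 0 \<le> t \<Longrightarrow> t \<le> 1 \<Longrightarrow> h' t - h' 0 \<le> K * t"
  shows "h 1 \<le> h 0 + h' 0 + K / 2"
proof -
  define p where "p t = h t - t * h' 0 - K / 2 * t\<^sup>2" for t
  have "p 1 \<le> p 0"
  proof (rule DERIV_nonpos_imp_nonincreasing[of 0 1 p])
    fix t :: real
    assume t: "0 \<le> t" "t \<le> 1"
    have "(p has_real_derivative (h' t - h' 0 - K * t)) (at t)"
      unfolding p_def using der[OF t] by (auto intro!: derivative_eq_intros simp: field_simps)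
    then show "\<exists>y. (p has_real_derivative y) (at t) \<and> y \<le> 0"
      using lip[OF t] by (intro exI[of _ "h' t - h' 0 - K * t"]) simp
  qed simp
  then show ?thesis by (simp add: p_def)
qed

lemma segment_point_in_convex:
  fixes x d :: "'a::real_vector"
  assumes "convex X" "x \<in> X" "x + d \<in> X" "0 \<le> t" "t \<le> 1"
  shows "x + t *\<^sub>R d \<in> X"
proof -
  have "(1 - t) *\<^sub>R x + t *\<^sub>R (x + d) \<in> X"
    using assms by (intro convexD) auto
  then show ?thesis by (simp add: algebra_simps)
qed

text \<open>The descent lemma: convexity keeps the segment inside \<open>X\<close>, where
  Cauchy-Schwarz and the Lipschitz bound control the growth of the directional derivative.\<close>

lemma gradient_quadratic_bound:
  fixes f :: "'a::real_inner \<Rightarrow> real"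
  assumes X: "convex X" "x \<in> X" "x + d \<in> X"
    and der: "\<And>y. y \<in> X \<Longrightarrow> GDERIV f y :> g y"
    and lip: "\<And>y z. y \<in> X \<Longrightarrow> z \<in> X \<Longrightarrow> norm (g y - g z) \<le> L * norm (y - z)"
  shows "f (x + d) \<le> f x + g x \<bullet> d + L / 2 * (norm d)\<^sup>2"
proof -
  have "f (x + 1 *\<^sub>R d) \<le> f (x + 0 *\<^sub>R d) + g (x + 0 *\<^sub>R d) \<bullet> d + L * (norm d)\<^sup>2 / 2"
  proof (rule quadratic_upper_bound[where h = "\<lambda>t. f (x + t *\<^sub>R d)"
        and h' = "\<lambda>t. g (x + t *\<^sub>R d) \<bullet> d"])
    fix t :: real
    assume t: "0 \<le> t" "t \<le> 1"
    have inX: "x + t *\<^sub>R d \<in> X"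
      by (rule segment_point_in_convex[OF X t])
    have "(f has_derivative (\<lambda>h. h \<bullet> g (x + t *\<^sub>R d))) (at (x + t *\<^sub>R d))"
      using der[OF inX] by (simp add: gderiv_def)
    then have "((\<lambda>t. f (x + t *\<^sub>R d)) has_derivative (\<lambda>s. (s *\<^sub>R d) \<bullet> g (x + t *\<^sub>R d))) (at t)"
      by (rule has_derivative_compose[of "\<lambda>t. x + t *\<^sub>R d" "\<lambda>s. s *\<^sub>R d" t UNIV f, rotated])
        (auto intro!: derivative_eq_intros)
    then show "((\<lambda>t. f (x + t *\<^sub>R d)) has_real_derivative g (x + t *\<^sub>R d) \<bullet> d) (at t)"
      by (rule has_derivative_imp_has_field_derivative) (simp add: inner_commute)
    have "g (x + t *\<^sub>R d) \<bullet> d - g x \<bullet> d \<le> norm (g (x + t *\<^sub>R d) - g x) * norm d"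
      using norm_cauchy_schwarz[of "g (x + t *\<^sub>R d) - g x" d] by (simp add: inner_diff_left)
    also have "\<dots> \<le> (L * norm (t *\<^sub>R d)) * norm d"
      using lip[OF inX X(2)] by (intro mult_right_mono) simp_all
    finally show "g (x + t *\<^sub>R d) \<bullet> d - g (x + 0 *\<^sub>R d) \<bullet> d \<le> L * (norm d)\<^sup>2 * t"
      using t by (simp add: power2_eq_square algebra_simps)
  qed
  then show ?thesis by simp
qed

text \<open>To reduce to a scalar function, \<open>F\<close> is tested against its own remainder
  \<open>w\<close>; the factor \<open>norm w\<close> that appears on both sides is then
  cancelled.\<close>

lemma jacobian_quadratic_bound:
  fixes F :: "real^'n::finite \<Rightarrow> real^'m::finite"
  assumes X: "convex X" "x \<in> X" "x + d \<in> X"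
    and der: "\<And>y. y \<in> X \<Longrightarrow> (F has_derivative (*v) (A y)) (at y)"
    and lip: "\<And>y z. y \<in> X \<Longrightarrow> z \<in> X \<Longrightarrow> spec_norm (A y - A z) \<le> L * norm (y - z)"
  shows "norm (F (x + d) - F x - A x *v d) \<le> L / 2 * (norm d)\<^sup>2"
proof -
  define w where "w = F (x + d) - F x - A x *v d"
  have "w \<bullet> F (x + 1 *\<^sub>R d) \<le> w \<bullet> F (x + 0 *\<^sub>R d) + w \<bullet> (A (x + 0 *\<^sub>R d) *v d)
      + norm w * L * (norm d)\<^sup>2 / 2"
  proof (rule quadratic_upper_bound[where h = "\<lambda>t. w \<bullet> F (x + t *\<^sub>R d)"
        and h' = "\<lambda>t. w \<bullet> (A (x + t *\<^sub>R d) *v d)"])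
    fix t :: real
    assume t: "0 \<le> t" "t \<le> 1"
    have inX: "x + t *\<^sub>R d \<in> X"
      by (rule segment_point_in_convex[OF X t])
    have "((\<lambda>t. F (x + t *\<^sub>R d)) has_derivative (\<lambda>s. A (x + t *\<^sub>R d) *v (s *\<^sub>R d))) (at t)"
      by (rule has_derivative_compose[of "\<lambda>t. x + t *\<^sub>R d" "\<lambda>s. s *\<^sub>R d" t UNIV F,
            OF _ der[OF inX]]) (auto intro!: derivative_eq_intros)
    then show "((\<lambda>t. w \<bullet> F (x + t *\<^sub>R d)) has_real_derivative w \<bullet> (A (x + t *\<^sub>R d) *v d)) (at t)"
      by (rule has_derivative_imp_has_field_derivative[OF has_derivative_inner_right])
        (simp add: matrix_vector_mult_scaleR)
    have "w \<bullet> (A (x + t *\<^sub>R d) *v d) - w \<bullet> (A x *v d)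
        \<le> norm w * norm ((A (x + t *\<^sub>R d) - A x) *v d)"
      using norm_cauchy_schwarz[of w "(A (x + t *\<^sub>R d) - A x) *v d"]
      by (simp add: inner_diff_right matrix_vector_mult_diff_rdistrib)
    also have "\<dots> \<le> norm w * (spec_norm (A (x + t *\<^sub>R d) - A x) * norm d)"
      by (intro mult_left_mono spec_norm_bound) simp
    also have "\<dots> \<le> norm w * ((L * norm (t *\<^sub>R d)) * norm d)"
      using lip[OF inX X(2)] by (intro mult_left_mono mult_right_mono) simp_all
    finally show "w \<bullet> (A (x + t *\<^sub>R d) *v d) - w \<bullet> (A (x + 0 *\<^sub>R d) *v d)
        \<le> norm w * L * (norm d)\<^sup>2 * t"
      using t by (simp add: power2_eq_square algebra_simps)
  qed
  then have "norm w * norm w \<le> norm w * (L / 2 * (norm d)\<^sup>2)"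
    by (simp add: w_def inner_diff_right inner_simps norm_mult flip: power2_eq_square)
      (simp add: power2_norm_eq_inner w_def inner_simps)
  show ?thesis
  proof (cases "w = 0")
    case True
    \<comment> \<open>No sign of \<open>L\<close> is assumed; the Lipschitz bound itself yields
      \<open>0 \<le> L * norm d\<close>, so the right-hand side is nonnegative.\<close>
    have "0 \<le> spec_norm (A (x + d) - A x)"
      unfolding spec_norm_def by (rule onorm_pos_le[OF matrix_vector_mul_bounded_linear])
    also have "\<dots> \<le> L * norm d" using lip[OF X(3,2)] by simp
    finally have "0 \<le> L * norm d * norm d" by simp
    with True show ?thesis by (simp add: w_def power2_eq_square mult.assoc)
  next
    case False
    with \<open>norm w * norm w \<le> _\<close> show ?thesis by (simp add: w_def)
  qed
qed

text \<open>Barrier term of one slack component. Since the step is scaled by \<open>s\<close>, only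
  \<open>t = a * p\<close> matters, and \<open>ln y \<le> y - 1\<close> at
  \<open>y = 1 / (1 + t)\<close> leaves a remainder with denominator \<open>1 + t\<close>. The
  fraction-to-the-boundary condition bounds this denominator below by \<open>1 - e\<close>,
  independently of \<open>s\<close>.\<close>

lemma neg_ln_quadratic_bound:
  fixes s p a e :: real
  assumes "0 < s" "e < 1" "(1 - e) * s \<le> s + a * (s * p)"
  shows "- ln (s + a * (s * p)) \<le> - ln s - a * p + a\<^sup>2 * p\<^sup>2 / (1 - e)"
proof -
  define t where "t = a * p"
  have fac: "s + a * (s * p) = s * (1 + t)" by (simp add: t_def algebra_simps)
  have "s * (1 - e) \<le> s * (1 + t)" using assms(3) unfolding fac by (simp add: mult.commute)
  then have t: "1 - e \<le> 1 + t" using \<open>0 < s\<close> by simp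
  then have pos: "0 < 1 + t" using \<open>e < 1\<close> by simp
  have "- ln (1 + t) = ln (1 / (1 + t))" using pos by (simp add: ln_div)
  also have "\<dots> \<le> 1 / (1 + t) - 1" using pos by (intro ln_le_minus_one) simp
  also have "\<dots> = - t + t\<^sup>2 / (1 + t)" using pos by (simp add: field_simps power2_eq_square)
  also have "\<dots> \<le> - t + t\<^sup>2 / (1 - e)"
    using t \<open>e < 1\<close> by (intro add_left_mono divide_left_mono mult_pos_pos) auto
  finally show ?thesis
    using pos \<open>0 < s\<close> unfolding fac by (simp add: ln_mult t_def power_mult_distrib)
qed

section \<open>Steps computed from either data set\<close>

text \<open>The zero vector is feasible for the subproblem, so the minimizer cannot do
  worse.\<close>

lemma normal_step_reduces:
  assumes "normal_step w cv J v" "0 < w"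
  shows "norm (cv + J *v v) \<le> norm cv"
proof -
  have "0 \<in> range ((*v) (transpose J)) \<and> norm (0::real^_) \<le> w * norm (transpose J *v cv)"
    using assms(2) by (auto intro!: range_eqI[of _ _ 0])
  then have "\<not> 1/2 * (norm (cv + J *v 0))\<^sup>2 < 1/2 * (norm (cv + J *v v))\<^sup>2"
    using assms(1) unfolding normal_step_def is_arg_min_def by blast
  then show ?thesis by (simp add: not_less)
qed

context
  fixes P :: "('n::finite, 'q::finite) model" and c :: params
    and it :: "('n, 'q) iterates" and z :: "('n, 'q) steps"
  assumes valid: "valid_params c" and steps: "steps_from P c it z"
begin

lemma normal_step_le: "norm (ck P it k + Jk P it k *v nstep z k) \<le> norm (ck P it k)"
  using steps valid normal_step_reduces unfolding steps_from_def valid_params_def by blast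

text \<open>Second block row of the linear system; it puts \<open>dir - nstep\<close> into the null
  space of the Jacobian.\<close>

lemma Jk_dir: "Jk P it k *v dir z k = Jk P it k *v nstep z k"
  using steps unfolding steps_from_def kkt_system_def by blast

lemma mpar_eq: "ereal (mpar z k) = tau_update c (prev_tau c (mpar z) k)
    (tau_trial c (Wk it k) (gk P c it k) (ck P it k) (Jk P it k) (nstep z k) (dir z k))"
  using steps unfolding steps_from_def by blast

lemma tau_trial_nonneg:
  "0 \<le> tau_trial c (Wk it k) (gk P c it k) (ck P it k) (Jk P it k) (nstep z k) (dir z k)"
  using normal_step_le[of k] valid
  by (auto simp: tau_trial_def Let_def valid_params_def intro!: divide_nonneg_nonneg)

lemma mpar_le_trial:
  "ereal (mpar z k)
    \<le> tau_trial c (Wk it k) (gk P c it k) (ck P it k) (Jk P it k) (nstep z k) (dir z k)"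
  by (simp add: mpar_eq tau_update_def)

text \<open>A negative value could only stem from the trial value, which is nonnegative because the
  normal step does not increase the linearized residual.\<close>

lemma mpar_step:
  assumes "0 \<le> prev_tau c (mpar z) k"
  shows "0 \<le> mpar z k" "mpar z k \<le> prev_tau c (mpar z) k"
proof -
  let ?t = "prev_tau c (mpar z) k"
  let ?T = "tau_trial c (Wk it k) (gk P c it k) (ck P it k) (Jk P it k) (nstep z k) (dir z k)"
  have d: "0 \<le> (1 - delta_tau c) * ?t" "(1 - delta_tau c) * ?t \<le> ?t"
    using assms valid mult_right_mono[of "1 - delta_tau c" 1 ?t] by (auto simp: valid_params_def)
  have "ereal 0 \<le> ereal (mpar z k)"
    using assms tau_trial_nonneg[of k] d unfolding mpar_eq tau_update_def zero_ereal_def by auto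
  then show "0 \<le> mpar z k" by simp
  have "ereal (mpar z k) \<le> ereal ?t"
    using d unfolding mpar_eq tau_update_def by (auto intro: min.coboundedI1)
  then show "mpar z k \<le> ?t" by simp
qed

lemma mpar_bounds: "0 \<le> mpar z k \<and> mpar z k \<le> tau_init c"
proof (induction k)
  case 0
  then show ?case
    using mpar_step[of 0] valid by (auto simp: prev_tau_def valid_params_def)
next
  case (Suc k)
  then show ?case using mpar_step[of "Suc k"] by (auto simp: prev_tau_def)
qed

lemma mpar_nonneg: "0 \<le> mpar z k"
  using mpar_bounds by blast

lemma mpar_le_init: "mpar z k \<le> tau_init c"
  using mpar_bounds by blast

lemma mpar_antimono: "mpar z (Suc k) \<le> mpar z k"
  using mpar_step(2)[of "Suc k"] mpar_nonneg[of k] by (simp add: prev_tau_def)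

text \<open>The trial value is chosen such that the normal component pays for the objective.\<close>

lemma delta_m_nonneg:
  assumes psd: "\<And>p. p \<in> null_sp (Jk P it k) \<Longrightarrow> 0 \<le> p \<bullet> (Wk it k *v p)"
  shows "0 \<le> delta_m P c it k (dir z k) (mpar z k)"
proof -
  define u where "u = dir z k - nstep z k"
  define q where "q = u \<bullet> (Wk it k *v u)"
  define g where "g = gk P c it k \<bullet> dir z k"
  define r where "r = norm (ck P it k) - norm (ck P it k + Jk P it k *v nstep z k)"
  define t where "t = mpar z k"
  have "u \<in> null_sp (Jk P it k)"
    by (simp add: u_def null_sp_def matrix_vector_mult_diff_distrib Jk_dir)
  then have q: "0 \<le> q" unfolding q_def by (rule psd)
  have r: "0 \<le> r" using normal_step_le by (simp add: r_def)
  have t: "0 \<le> t" by (simp add: t_def mpar_nonneg)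
  \<comment> \<open>As \<open>J d = J v\<close>, this is the claim itself. If the trial value is
    infinite, then \<open>g \<le> - q / 2 \<le> 0\<close>. Otherwise \<open>t\<close> times the
    denominator is at most \<open>(1 - sigma_tau c) * r\<close>, and dropping the curvature term
    \<open>q\<close> only lowers the left side.\<close>
  have "t * g \<le> r"
  proof (cases "g + 1/2 * q \<le> 0")
    case True
    then have "t * g \<le> 0" using q t by (intro mult_nonneg_nonpos) auto
    then show ?thesis using r by simp
  next
    case False
    have "t \<le> (1 - sigma_tau c) * r / (g + 1/2 * q)"
      using mpar_le_trial[of k] False
      by (simp add: tau_trial_def Let_def t_def g_def q_def r_def u_def)
    then have "t * (g + 1/2 * q) \<le> (1 - sigma_tau c) * r"
      using False by (simp add: pos_le_divide_eq)
    moreover have "t * g \<le> t * (g + 1/2 * q)"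
      using q t by (intro mult_left_mono) auto
    moreover have "(1 - sigma_tau c) * r \<le> 1 * r"
      using r valid by (intro mult_right_mono) (auto simp: valid_params_def)
    ultimately show ?thesis by simp
  qed
  then show ?thesis
    by (simp add: delta_m_def Jk_dir t_def g_def r_def)
qed

end

section \<open>Merit function along the run\<close>

locale noisy_run =
  fixes M N :: "('n::finite, 'q::finite) model"
    and c :: params
    and it :: "('n, 'q) iterates"
    and st sb :: "('n, 'q) steps"
    and X :: "(real^'n) set"
    and Lg LJ :: real
  assumes run: "infinite_run M c it st"
    and noiseless: "steps_from N c it sb"
    and noise: "noise_assumption M N c it st X Lg LJ"
    and matrix: "matrix_assumption M N c it st sb"
    and slack: "slack_assumption it"
begin

section \<open>Consequences of the assumptions\<close>

lemma valid: "valid_params c"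
  and noisy: "steps_from M c it st"
  using run by (auto simp: infinite_run_def)

lemma run_step: "max_stepsize c it st k" "backtracking M c it st k"
    "itx it (Suc k) = itx it k + alph it k *\<^sub>R xpart (dir st k)"
    "its it (Suc k) = (\<chi> i. max ((its it k + alph it k *\<^sub>R sdir it st k) $ i)
                                   (- con M (itx it (Suc k)) $ i))"
  using run unfolding infinite_run_def by blast+

lemma par: "0 < mu c" "0 < zeta c" "0 < eta_s c" "eta_s c < 1" "0 < eta_phi c" "eta_phi c < 1"
    "0 < eps_f c" "0 < eps_g c" "0 < eps_c c" "0 < eps_J c" "0 < tau_init c"
  using valid by (auto simp: valid_params_def)

lemmas tau_nonneg = mpar_nonneg[OF valid noisy] mpar_nonneg[OF valid noiseless]
lemmas tau_le_init = mpar_le_init[OF valid noisy] mpar_le_init[OF valid noiseless]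

lemma convex_X: "convex X"
  and itx_X: "itx it k \<in> X"
  and trial_X: "alph it k \<le> amax it k / 2^j \<Longrightarrow>
      itx it k + (amax it k / 2^j) *\<^sub>R xpart (dir st k) \<in> X"
  and grad_N: "y \<in> X \<Longrightarrow> GDERIV (obj N) y :> grad N y"
  and jac_N: "y \<in> X \<Longrightarrow> (con N has_derivative (*v) (jac N y)) (at y)"
  and Lg: "0 < Lg" "y \<in> X \<Longrightarrow> y' \<in> X \<Longrightarrow> norm (grad N y - grad N y') \<le> Lg * norm (y - y')"
  and LJ: "0 < LJ" "y \<in> X \<Longrightarrow> y' \<in> X \<Longrightarrow> spec_norm (jac N y - jac N y') \<le> LJ * norm (y - y')"
  and noise_bounds: "y \<in> X \<Longrightarrow> \<bar>obj N y - obj M y\<bar> \<le> eps_f c"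
    "y \<in> X \<Longrightarrow> norm (grad N y - grad M y) \<le> eps_g c"
    "y \<in> X \<Longrightarrow> norm (con N y - con M y) \<le> eps_c c"
    "y \<in> X \<Longrightarrow> spec_norm (jac N y - jac M y) \<le> eps_J c"
  using noise unfolding noise_assumption_def by (elim conjE; blast)+

lemma delta_m_exact_nonneg: "0 \<le> delta_m N c it k (dir sb k) (mpar sb k)"
proof (rule delta_m_nonneg[OF valid noiseless])
  obtain w where "0 < w" "\<And>k p. p \<in> null_sp (Jk M it k) \<union> null_sp (Jk N it k) \<Longrightarrow>
      w * (norm p)\<^sup>2 \<le> p \<bullet> (Wk it k *v p)"
    using matrix unfolding matrix_assumption_def by blast
  then show "p \<in> null_sp (Jk N it k) \<Longrightarrow> 0 \<le> p \<bullet> (Wk it k *v p)" for p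
    by (meson UnCI mult_nonneg_nonneg order_trans zero_le_power2 less_imp_le)
qed

section \<open>Step sizes and positivity of the slacks\<close>

lemma amax_bounds: "0 < amax it k" "amax it k \<le> 1"
    "(1 - eta_s c) *\<^sub>R its it k \<le> its it k + amax it k *\<^sub>R sdir it st k"
  using run_step(1)[of k] by (simp_all add: max_stepsize_def Let_def)

lemma alph_bounds: "0 < alph it k" "alph it k \<le> amax it k"
proof -
  obtain j where "alph it k = amax it k / 2^j"
    using run_step(2)[of k] unfolding backtracking_def by blast
  then show "0 < alph it k" "alph it k \<le> amax it k"
    using amax_bounds(1)[of k] mult_left_mono[of 1 "2^j" "amax it k"]
    by (simp_all add: divide_le_eq)
qed

text \<open>The condition defining the maximal step size is inherited by shorter steps: a component
  with nonnegative direction does not move towards the boundary, and for a negative one the shorter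
  step decreases it less.\<close>

lemma fraction_to_boundary:
  assumes s: "0 < its it k $ i" and a: "0 \<le> a" "a \<le> amax it k"
  shows "(1 - eta_s c) * its it k $ i \<le> its it k $ i + a * (its it k $ i * spart (dir st k) $ i)"
proof -
  let ?s = "its it k $ i" and ?p = "spart (dir st k) $ i"
  have full: "(1 - eta_s c) * ?s \<le> ?s + amax it k * (?s * ?p)"
    using amax_bounds(3)[of k] by (simp add: less_eq_vec_def sdir_def diag_mult)
  show ?thesis
  proof (cases "0 \<le> ?p")
    case True
    then have "0 \<le> a * (?s * ?p)" "0 \<le> eta_s c * ?s"
      using s a par by auto
    then show ?thesis by (simp add: left_diff_distrib)
  next
    case False
    then have "amax it k * (?s * ?p) \<le> a * (?s * ?p)"
      using s a by (intro mult_right_mono_neg mult_nonneg_nonpos) auto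
    then show ?thesis using full by simp
  qed
qed

lemma slack_trial_pos:
  assumes "0 < its it k $ i" "0 \<le> a" "a \<le> amax it k"
  shows "0 < (its it k + a *\<^sub>R sdir it st k) $ i"
proof -
  have "0 < (1 - eta_s c) * its it k $ i" using assms par by simp
  then show ?thesis
    using fraction_to_boundary[OF assms] by (simp add: sdir_def diag_mult)
qed

text \<open>The line search stays inside the fraction-to-the-boundary region, and the subsequent
  reset can only enlarge a slack.\<close>

lemma slack_pos: "0 < its it k $ i"
proof (induction k)
  case 0
  then show ?case using run by (auto simp: infinite_run_def)
next
  case (Suc k)
  have "0 < (its it k + alph it k *\<^sub>R sdir it st k) $ i"
    using slack_trial_pos[OF Suc] alph_bounds[of k] by simp
  then show ?case by (simp add: run_step(4) less_max_iff_disj)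
qed

text \<open>The objective, barrier and constraint terms each have a first-order part contained in
  \<open>delta_m\<close> and a quadratic remainder. Convexity of the norm, with
  \<open>a \<le> 1\<close>, interpolates between the current and the linearized constraint
  residual.\<close>

lemma exact_merit_bound:
  assumes a: "0 \<le> a" "a \<le> amax it k"
    and inX: "itx it k + a *\<^sub>R xpart (dir st k) \<in> X" and \<tau>: "0 \<le> \<tau>"
  shows "merit N c (itx it k + a *\<^sub>R xpart (dir st k)) (its it k + a *\<^sub>R sdir it st k) \<tau>
    \<le> merit N c (itx it k) (its it k) \<tau> - a * delta_m N c it k (dir st k) \<tau>
      + xi2 c Lg LJ \<tau> * a\<^sup>2 * (norm (dir st k))\<^sup>2"
proof -
  define x s d where "x = itx it k" and "s = its it k" and "d = dir st k"
  define dx ds where "dx = xpart d" and "ds = spart d"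
  note defs = x_def s_def d_def dx_def ds_def
  have a1: "a \<le> 1" using a amax_bounds[of k] by simp
  have X: "x \<in> X" "x + a *\<^sub>R dx \<in> X" using inX itx_X by (simp_all add: defs)
  have sd: "sdir it st k $ i = s $ i * ds $ i" for i
    by (simp add: sdir_def diag_mult defs)

  have obj: "obj N (x + a *\<^sub>R dx) \<le> obj N x + a * (grad N x \<bullet> dx) + Lg / 2 * (a\<^sup>2 * (norm dx)\<^sup>2)"
    using gradient_quadratic_bound[OF convex_X X grad_N Lg(2)]
    by (simp add: power_mult_distrib)

  \<comment> \<open>The slack direction is scaled by \<open>s\<close>, which cancels the factor
    \<open>1 / s\<close> of the barrier derivative; therefore the slack block of the gradient is the
    constant \<open>- mu c\<close>.\<close>
  have gd: "gk N c it k \<bullet> d = grad N x \<bullet> dx - mu c * (\<Sum>i\<in>UNIV. ds $ i)"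
    by (simp add: gk_def barg_def inner_stack flip: defs)
      (simp add: inner_vec_def sum_distrib_left sum_negf)
  have "(\<Sum>i\<in>UNIV. - ln ((s + a *\<^sub>R sdir it st k) $ i))
      \<le> (\<Sum>i\<in>UNIV. - ln (s $ i) - a * ds $ i + a\<^sup>2 * (ds $ i)\<^sup>2 / (1 - eta_s c))"
    using neg_ln_quadratic_bound[OF slack_pos par(4) fraction_to_boundary[OF slack_pos a]]
    by (intro sum_mono) (simp add: sd, simp add: defs)
  also have "\<dots> = - (\<Sum>i\<in>UNIV. ln (s $ i)) - a * (\<Sum>i\<in>UNIV. ds $ i)
      + a\<^sup>2 * (norm ds)\<^sup>2 / (1 - eta_s c)"
    by (simp only: power2_norm_eq_inner inner_vec_def)
      (simp add: sum.distrib sum_subtractf sum_negf sum_distrib_left sum_divide_distrib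
        power2_eq_square)
  finally have "mu c * (- (\<Sum>i\<in>UNIV. ln ((s + a *\<^sub>R sdir it st k) $ i)))
      \<le> mu c * (- (\<Sum>i\<in>UNIV. ln (s $ i)) - a * (\<Sum>i\<in>UNIV. ds $ i)
      + a\<^sup>2 * (norm ds)\<^sup>2 / (1 - eta_s c))"
    using par by (intro mult_left_mono) (simp_all add: sum_negf)
  with obj have barf: "barf N c (x + a *\<^sub>R dx) (s + a *\<^sub>R sdir it st k)
      \<le> barf N c x s + a * (gk N c it k \<bullet> d)
        + (Lg / 2 * (a\<^sup>2 * (norm dx)\<^sup>2) + mu c * (a\<^sup>2 * (norm ds)\<^sup>2 / (1 - eta_s c)))"
    by (simp add: barf_def gd algebra_simps)

  let ?r = "con N (x + a *\<^sub>R dx) - con N x - jac N x *v (a *\<^sub>R dx)"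
  have rem: "norm ?r \<le> LJ / 2 * (a\<^sup>2 * (norm dx)\<^sup>2)"
    using jacobian_quadratic_bound[OF convex_X X jac_N LJ(2)] by (simp add: power_mult_distrib)
  \<comment> \<open>The slack enters the constraint linearly, so only \<open>con N\<close>
    contributes to the remainder.\<close>
  have "barc N (x + a *\<^sub>R dx) (s + a *\<^sub>R sdir it st k)
      = (1 - a) *\<^sub>R ck N it k + a *\<^sub>R (ck N it k + Jk N it k *v d) + ?r"
    by (simp add: barc_def ck_def Jk_def barJ_def beside_mult sdir_def matrix_vector_mult_scaleR
        algebra_simps flip: defs)
  also have "norm \<dots> \<le> (1 - a) * norm (ck N it k) + a * norm (ck N it k + Jk N it k *v d) + norm ?r"
    using a a1 by (intro order_trans[OF norm_triangle_ineq] add_right_mono)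
      (auto intro!: order_trans[OF norm_triangle_ineq])
  finally have con: "norm (barc N (x + a *\<^sub>R dx) (s + a *\<^sub>R sdir it st k))
      \<le> (1 - a) * norm (ck N it k) + a * norm (ck N it k + Jk N it k *v d)
        + LJ / 2 * (a\<^sup>2 * (norm dx)\<^sup>2)"
    using rem by simp

  \<comment> \<open>The two blocks of the direction have different curvature constants;
    \<open>xi2\<close> is their maximum, and the squared norms of the blocks add up.\<close>
  have "1/2 * (\<tau> * Lg + LJ) * (a\<^sup>2 * (norm dx)\<^sup>2) + \<tau> * mu c / (1 - eta_s c) * (a\<^sup>2 * (norm ds)\<^sup>2)
      \<le> xi2 c Lg LJ \<tau> * (a\<^sup>2 * (norm dx)\<^sup>2) + xi2 c Lg LJ \<tau> * (a\<^sup>2 * (norm ds)\<^sup>2)"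
    unfolding xi2_def by (intro add_mono mult_right_mono) auto
  also have "\<dots> = xi2 c Lg LJ \<tau> * a\<^sup>2 * (norm d)\<^sup>2"
    by (simp add: norm_xpart_spart[of d] dx_def ds_def algebra_simps)
  finally have quad: "\<tau> * (Lg / 2 * (a\<^sup>2 * (norm dx)\<^sup>2) + mu c * (a\<^sup>2 * (norm ds)\<^sup>2 / (1 - eta_s c)))
      + LJ / 2 * (a\<^sup>2 * (norm dx)\<^sup>2) \<le> xi2 c Lg LJ \<tau> * a\<^sup>2 * (norm d)\<^sup>2"
    by (simp add: algebra_simps add_divide_distrib)
  have "\<tau> * barf N c (x + a *\<^sub>R dx) (s + a *\<^sub>R sdir it st k) + norm (barc N (x + a *\<^sub>R dx) (s + a *\<^sub>R sdir it st k))
      \<le> \<tau> * (barf N c x s + a * (gk N c it k \<bullet> d)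
        + (Lg / 2 * (a\<^sup>2 * (norm dx)\<^sup>2) + mu c * (a\<^sup>2 * (norm ds)\<^sup>2 / (1 - eta_s c))))
      + ((1 - a) * norm (ck N it k) + a * norm (ck N it k + Jk N it k *v d)
        + LJ / 2 * (a\<^sup>2 * (norm dx)\<^sup>2))"
    using barf con \<tau> by (intro add_mono mult_left_mono)
  also have "\<dots> = (\<tau> * barf N c x s + norm (ck N it k)) - a * delta_m N c it k d \<tau>
      + (\<tau> * (Lg / 2 * (a\<^sup>2 * (norm dx)\<^sup>2) + mu c * (a\<^sup>2 * (norm ds)\<^sup>2 / (1 - eta_s c)))
      + LJ / 2 * (a\<^sup>2 * (norm dx)\<^sup>2))"
    unfolding delta_m_def by algebra
  finally show ?thesis
    using quad by (simp add: merit_def ck_def flip: defs)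
qed

text \<open>The barrier and the slack are the same in both merit functions, so noise enters only
  through \<open>obj\<close> and \<open>con\<close>, and the bound is uniform in
  \<open>s\<close>.\<close>

lemma merit_noise:
  assumes "x \<in> X" "0 \<le> \<tau>"
  shows "\<bar>merit N c x s \<tau> - merit M c x s \<tau>\<bar> \<le> \<tau> * eps_f c + eps_c c"
proof -
  have "merit N c x s \<tau> - merit M c x s \<tau>
      = \<tau> * (obj N x - obj M x) + (norm (barc N x s) - norm (barc M x s))"
    by (simp add: merit_def barf_def algebra_simps)
  moreover have "\<bar>\<tau> * (obj N x - obj M x)\<bar> \<le> \<tau> * eps_f c"
    using assms noise_bounds(1) by (simp add: abs_mult mult_left_mono)
  moreover have "\<bar>norm (barc N x s) - norm (barc M x s)\<bar> \<le> norm (con N x - con M x)"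
    using norm_triangle_ineq3[of "barc N x s" "barc M x s"] by (simp add: barc_def)
  ultimately show ?thesis using noise_bounds(3)[OF assms(1)] by linarith
qed

text \<open>Larger slacks lower the barrier term, and each component of the constraint turns from
  \<open>r\<close> into \<open>max r 0\<close>, which is no larger in absolute value.\<close>

lemma slack_reset_merit:
  assumes "\<And>i. 0 < s $ i" "0 \<le> \<tau>"
  shows "merit M c x (\<chi> i. max (s $ i) (- con M x $ i)) \<tau> \<le> merit M c x s \<tau>"
proof -
  have "(\<Sum>i\<in>UNIV. ln (s $ i)) \<le> (\<Sum>i\<in>UNIV. ln (max (s $ i) (- con M x $ i)))"
    using assms(1) by (intro sum_mono) (auto simp: less_max_iff_disj)
  then have "\<tau> * barf M c x (\<chi> i. max (s $ i) (- con M x $ i)) \<le> \<tau> * barf M c x s"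
    using par assms(2) by (intro mult_left_mono) (simp_all add: barf_def)
  moreover have "norm (barc M x (\<chi> i. max (s $ i) (- con M x $ i))) \<le> norm (barc M x s)"
    by (rule norm_le_componentwise_cart) (auto simp: barc_def max_def)
  ultimately show ?thesis by (simp add: merit_def)
qed

text \<open>Only unbounded slacks could drive the barrier term to minus infinity, and the slack
  bound excludes them.\<close>

lemma barf_bounded_below: "\<exists>F. \<forall>k. F \<le> barf M c (itx it k) (its it k)"
proof -
  obtain m where m: "\<And>x. x \<in> X \<Longrightarrow> m \<le> obj N x"
    using noise unfolding noise_assumption_def bdd_below.unfold by fast
  obtain S where S: "0 < S" "\<And>k. norm (its it k) \<le> S"
    using slack unfolding slack_assumption_def by blast
  have "m - eps_f c - mu c * (\<Sum>i\<in>(UNIV::'q set). ln S) \<le> barf M c (itx it k) (its it k)" for k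
  proof -
    have "its it k $ i \<le> S" for i
      using S(2)[of k] component_le_norm_cart[of "its it k" i] by linarith
    then have "(\<Sum>i\<in>UNIV. ln (its it k $ i)) \<le> (\<Sum>i\<in>(UNIV::'q set). ln S)"
      using slack_pos S(1) by (intro sum_mono) simp
    then have "mu c * (\<Sum>i\<in>UNIV. ln (its it k $ i)) \<le> mu c * (\<Sum>i\<in>(UNIV::'q set). ln S)"
      using par by (intro mult_left_mono) auto
    moreover have "m - eps_f c \<le> obj M (itx it k)"
      using m[OF itx_X[of k]] noise_bounds(1)[OF itx_X[of k]] by linarith
    ultimately show ?thesis by (simp add: barf_def)
  qed
  then show ?thesis by blast
qed

section \<open>Noise in the model reduction\<close>

lemma delta_m_mixed:
  "delta_m N c it k (dir st k) (mpar st k)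
    = delta_m N c it k (dir sb k) (mpar sb k) + E_m2 N c it st sb k"
proof -
  have "ck N it k + Jk N it k *v dir sb k + Jk N it k *v (dir st k - dir sb k)
      = ck N it k + Jk N it k *v dir st k"
    by (simp add: matrix_vector_mult_diff_distrib)
  then show ?thesis
    unfolding delta_m_def E_m2_def Let_def inner_diff_right
    by (simp add: algebra_simps)
qed

text \<open>Complements \<open>delta_m_mixed\<close>: there the direction and the merit parameter
  change under exact data, here the data change at fixed direction and parameter. The quantity in
  between, exact data along the noisy direction, is the one in
  \<open>exact_merit_bound\<close>.\<close>

lemma delta_m_data:
  "delta_m M c it k (dir st k) (mpar st k)
    = delta_m N c it k (dir st k) (mpar st k) + E_m1 M N c it st sb k"
proof -
  have N: "ck N it k + Jk N it k *v dir sb k + Jk N it k *v (dir st k - dir sb k)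
      = ck N it k + Jk N it k *v dir st k"
    by (simp add: matrix_vector_mult_diff_distrib)
  have M: "ck N it k + Jk N it k *v dir st k + (ck M it k - ck N it k)
        + (Jk M it k - Jk N it k) *v dir sb k
        + (Jk M it k - Jk N it k) *v (dir st k - dir sb k)
      = ck M it k + Jk M it k *v dir st k"
    by (simp add: matrix_vector_mult_diff_distrib matrix_vector_mult_diff_rdistrib)
  show ?thesis
    unfolding E_m1_def Let_def N M by (simp add: delta_m_def inner_diff_left algebra_simps)
qed

lemma delta_m_noisy:
  "delta_m M c it k (dir st k) (mpar st k)
    = delta_m N c it k (dir sb k) (mpar sb k) + E_m M N c it st sb k"
  by (simp add: delta_m_data delta_m_mixed E_m_def)

section \<open>Positive constants and the step size \<open>alpha_hat\<close>\<close>

lemma xi2_pos: "0 \<le> \<tau> \<Longrightarrow> 0 < xi2 c Lg LJ \<tau>"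
  using Lg(1) LJ(1) add_nonneg_pos[of "\<tau> * Lg" LJ] by (simp add: xi2_def less_max_iff_disj)

lemma xi2_mpar_pos: "0 < xi2 c Lg LJ (mpar st k)"
  by (simp add: xi2_pos tau_nonneg)

lemma eps_k_ge: "eps_c c \<le> eps_k c st k"
  using tau_nonneg(1)[of k] par by (simp add: eps_k_def)

lemma eps_k_pos: "0 < eps_k c st k"
  using eps_k_ge[of k] par by linarith

text \<open>The last property is the purpose: up to \<open>h\<close>, the quadratic remainder of
  \<open>exact_merit_bound\<close> per unit of step size stays below half of
  \<open>(1 - eta_phi c)\<close> times the noiseless reduction.\<close>

lemma alpha_hat_real:
  assumes D: "0 < delta_m N c it k (dir sb k) (mpar sb k)"
  obtains h where "alpha_hat N c Lg LJ it st sb k = ereal h" "0 < h" "h \<le> amax it k"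
    "xi2 c Lg LJ (mpar st k) * h * (norm (dir st k))\<^sup>2
      \<le> (1 - eta_phi c) * delta_m N c it k (dir sb k) (mpar sb k) / 2"
proof -
  define A where "A = (1 - eta_phi c) * delta_m N c it k (dir sb k) (mpar sb k)"
  define q where "q = 2 * xi2 c Lg LJ (mpar st k) * (norm (dir st k))\<^sup>2"
  have A: "0 < A" using D par by (simp add: A_def)
  have hat: "alpha_hat N c Lg LJ it st sb k = min (ereal A / ereal q) (ereal (amax it k))"
    by (simp add: alpha_hat_def Let_def A_def q_def)
  show thesis
  proof (cases "q = 0")
    \<comment> \<open>The denominator vanishes only for a zero direction. The fraction is then
      infinite, the cap \<open>amax\<close> remains, and there is no quadratic remainder.\<close>
    case True
    show thesis
    proof (rule that)
      show "alpha_hat N c Lg LJ it st sb k = ereal (amax it k)"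
        using True A by (simp add: hat ereal_pos_divide_zero flip: zero_ereal_def)
      show "xi2 c Lg LJ (mpar st k) * amax it k * (norm (dir st k))\<^sup>2
          \<le> (1 - eta_phi c) * delta_m N c it k (dir sb k) (mpar sb k) / 2"
        using True A xi2_mpar_pos[of k] by (simp add: q_def A_def)
    qed (simp_all add: amax_bounds)
  next
    case False
    then have q: "0 < q" using xi2_mpar_pos[of k] by (simp add: q_def)
    show thesis
    proof (rule that)
      show "alpha_hat N c Lg LJ it st sb k = ereal (min (A / q) (amax it k))"
        using False by (simp add: hat min_def)
      show "0 < min (A / q) (amax it k)" using A q amax_bounds by simp
      have "q * min (A / q) (amax it k) \<le> q * (A / q)"
        using q by (intro mult_left_mono) auto
      also have "\<dots> = A" using q by simp
      finally show "xi2 c Lg LJ (mpar st k) * min (A / q) (amax it k) * (norm (dir st k))\<^sup>2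
          \<le> (1 - eta_phi c) * delta_m N c it k (dir sb k) (mpar sb k) / 2"
        by (simp add: q_def A_def mult_ac)
    qed simp
  qed
qed

text \<open>The fraction is zero even if its denominator vanishes, because \<open>0 / 0 = 0\<close>.
  The third term of the maximum is then infinite.\<close>

lemma alpha_hat_zero:
  assumes "delta_m N c it k (dir sb k) (mpar sb k) = 0"
  shows "alpha_hat N c Lg LJ it st sb k = 0"
  using assms amax_bounds(1)[of k]
  by (simp add: alpha_hat_def Let_def min_def flip: zero_ereal_def)

text \<open>The premises negate the three terms of the maximum: \<open>b1\<close> yields
  \<open>gap\<close>, \<open>b2\<close> yields \<open>half\<close>, and \<open>b3\<close> excludes
  \<open>D = 0\<close> and yields \<open>drop\<close>.\<close>

lemma merit_decrease:
  fixes k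
  defines "D \<equiv> delta_m N c it k (dir sb k) (mpar sb k)"
  assumes b1: "2 * (eta_phi c * E_m1 M N c it st sb k - (1 - eta_phi c) * E_m2 N c it st sb k)
      / (1 - eta_phi c) < D"
    and b2: "- 2 * E_m M N c it st sb k < D"
    and b3: "ereal (4 * (4 + 2 * zeta c) * eps_k c st k)
      / (alpha_hat N c Lg LJ it st sb k * ereal (eta_phi c)) < ereal D"
  shows "merit M c (itx it (Suc k)) (its it (Suc k)) (mpar st k)
    \<le> merit M c (itx it k) (its it k) (mpar st k) - (2 + zeta c) * eps_k c st k"
proof -
  define \<tau> where "\<tau> = mpar st k"
  define \<eta> where "\<eta> = eta_phi c"
  define e where "e = eps_k c st k"
  define \<xi> where "\<xi> = xi2 c Lg LJ \<tau>"
  define n where "n = (norm (dir st k))\<^sup>2"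
  define DM where "DM = delta_m M c it k (dir st k) \<tau>"
  define DX where "DX = delta_m N c it k (dir st k) \<tau>"
  have \<eta>: "0 < \<eta>" "\<eta> < 1" using par by (simp_all add: \<eta>_def)
  have e: "0 < e" "e = \<tau> * eps_f c + eps_c c"
    using eps_k_pos[of k] by (simp_all add: e_def eps_k_def \<tau>_def)
  have \<tau>: "0 \<le> \<tau>" by (simp add: \<tau>_def tau_nonneg)
  have \<xi>: "0 < \<xi>" by (simp add: \<xi>_def \<tau>_def xi2_mpar_pos)
  have "D \<noteq> 0"
  proof
    assume "D = 0"
    then show False
      using b3 par e(1) alpha_hat_zero[of k] by (simp add: D_def e_def ereal_pos_divide_zero)
  qed
  then have D: "0 < D" using delta_m_exact_nonneg[of k] by (simp add: D_def)
  then obtain h where h: "alpha_hat N c Lg LJ it st sb k = ereal h" "0 < h" "h \<le> amax it k"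
    "\<xi> * h * n \<le> (1 - \<eta>) * D / 2"
    using alpha_hat_real[of k] by (auto simp: D_def \<xi>_def \<tau>_def n_def \<eta>_def)

  have DM: "DM = D + E_m1 M N c it st sb k + E_m2 N c it st sb k"
    by (simp add: DM_def D_def \<tau>_def delta_m_noisy E_m_def)
  have DX: "DX = D + E_m2 N c it st sb k"
    by (simp add: DX_def D_def \<tau>_def delta_m_mixed)
  have "2 * (\<eta> * E_m1 M N c it st sb k - (1 - \<eta>) * E_m2 N c it st sb k) < D * (1 - \<eta>)"
    using b1 \<eta> by (simp add: pos_divide_less_eq flip: \<eta>_def)
  \<comment> \<open>The right-hand side equals \<open>(1 - \<eta>) * D\<close> minus the error
    \<open>\<eta> * E_m1 - (1 - \<eta>) * E_m2\<close>, and by \<open>b1\<close> this error takes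
    less than half of it.\<close>
  then have gap: "(1 - \<eta>) * D / 2 \<le> DX - \<eta> * DM"
    unfolding DM DX by (simp add: field_simps)
  have half: "D / 2 \<le> DM"
    using b2 by (simp add: DM E_m_def)

  \<comment> \<open>Passing to the exact merit function costs at most \<open>e\<close> at either end
    of the step; the relaxation \<open>(2 + zeta c) * e\<close> pays for both.\<close>
  have suff: "sufficient_decrease M c it st k a"
    if a: "0 \<le> a" "a \<le> h" and inX: "itx it k + a *\<^sub>R xpart (dir st k) \<in> X" for a
  proof -
    let ?x = "itx it k + a *\<^sub>R xpart (dir st k)" and ?s = "its it k + a *\<^sub>R sdir it st k"
    have "\<xi> * a * n \<le> \<xi> * h * n"
      using a \<xi> by (intro mult_right_mono mult_left_mono) (simp_all add: n_def)
    then have "\<xi> * a * n \<le> DX - \<eta> * DM" using h(4) gap by linarith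
    then have "a * (\<xi> * a * n) \<le> a * (DX - \<eta> * DM)"
      using a by (intro mult_left_mono)
    then have quad: "\<xi> * a\<^sup>2 * n - a * DX \<le> - \<eta> * a * DM"
      by (simp add: power2_eq_square algebra_simps)
    have "merit N c ?x ?s \<tau> \<le> merit N c (itx it k) (its it k) \<tau> - a * DX + \<xi> * a\<^sup>2 * n"
      using exact_merit_bound[of a k \<tau>] a h(3) inX \<tau> by (simp add: DX_def \<xi>_def n_def)
    moreover have "0 \<le> zeta c * e" using par e by simp
    ultimately have "merit M c ?x ?s \<tau>
        \<le> merit M c (itx it k) (its it k) \<tau> - \<eta> * a * DM + (2 + zeta c) * e"
      using quad merit_noise[OF inX \<tau>, of ?s] merit_noise[OF itx_X[of k] \<tau>, of "its it k"] e(2)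
      by (simp add: distrib_right)
    then show ?thesis
      by (simp add: sufficient_decrease_def \<tau>_def \<eta>_def e_def DM_def)
  qed

  obtain j where j: "sufficient_decrease M c it st k (amax it k / 2^j)"
      "\<And>i. i < j \<Longrightarrow> \<not> sufficient_decrease M c it st k (amax it k / 2^i)"
      "alph it k = amax it k / 2^j"
    using run_step(2)[of k] unfolding backtracking_def by blast
  have step: "h / 2 \<le> alph it k"
  proof (cases j)
    case 0
    then show ?thesis using j(3) h by simp
  next
    case (Suc i)
    \<comment> \<open>The last rejected trial size is twice the accepted one. Its trial point lies
      in \<open>X\<close>, so by \<open>suff\<close> the rejection means that it exceeds
      \<open>h\<close>.\<close>
    let ?a = "amax it k / 2^i"
    have a: "?a = 2 * alph it k" using j(3) Suc by simp
    then have "itx it k + ?a *\<^sub>R xpart (dir st k) \<in> X"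
      using alph_bounds(1)[of k] by (intro trial_X) simp
    then have "\<not> ?a \<le> h"
      using suff[of ?a] j(2)[of i] Suc a alph_bounds(1)[of k] by auto
    then show ?thesis using a by simp
  qed

  \<comment> \<open>Replacing \<open>h\<close> by the accepted step size and \<open>D\<close> by
    \<open>DM\<close> costs a factor 2 each, which accounts for the leading 4. The factor
    \<open>4 + 2 * zeta c\<close> is twice that of the relaxation, so a decrease of
    \<open>(2 + zeta c) * e\<close> is left after the relaxation.\<close>
  have "ereal (4 * (4 + 2 * zeta c) * e / (h * \<eta>)) < ereal D"
    using b3 h \<eta> by (simp add: e_def \<eta>_def)
  then have "4 * (4 + 2 * zeta c) * e < D * (h * \<eta>)"
    using h \<eta> by (simp add: pos_divide_less_eq)
  also have "\<dots> = 4 * (\<eta> * (h / 2) * (D / 2))" by simp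
  also have "\<dots> \<le> 4 * (\<eta> * alph it k * DM)"
    using step half D h \<eta> alph_bounds(1)[of k] by (intro mult_left_mono mult_mono) auto
  finally have drop: "2 * (2 + zeta c) * e \<le> \<eta> * alph it k * DM"
    by (simp add: algebra_simps)

  let ?s = "its it k + alph it k *\<^sub>R sdir it st k"
  have "merit M c (itx it (Suc k)) (its it (Suc k)) \<tau> \<le> merit M c (itx it (Suc k)) ?s \<tau>"
    unfolding run_step(4)
    by (rule slack_reset_merit[OF slack_trial_pos[OF slack_pos] \<tau>])
      (use alph_bounds[of k] in auto)
  also have "\<dots> \<le> merit M c (itx it k) (its it k) \<tau> - \<eta> * alph it k * DM + (2 + zeta c) * e"
    using j(1) by (simp add: sufficient_decrease_def run_step(3) j(3) \<tau>_def \<eta>_def e_def DM_def)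
  finally show ?thesis using drop by (simp add: \<tau>_def e_def algebra_simps)
qed

text \<open>Shifting the objective by a lower bound makes the merit function nonnegative and monotone in
  the merit parameter, so decreases with respect to varying merit parameters accumulate.\<close>

lemma model_reduction_bound_frequently:
  "\<exists>k\<ge>K. ereal (delta_m N c it k (dir sb k) (mpar sb k))
      \<le> Max {ereal (2 * (eta_phi c * E_m1 M N c it st sb k
                           - (1 - eta_phi c) * E_m2 N c it st sb k) / (1 - eta_phi c)),
              ereal (- 2 * E_m M N c it st sb k),
              ereal (4 * (4 + 2 * zeta c) * eps_k c st k)
                / (alpha_hat N c Lg LJ it st sb k * ereal (eta_phi c))}"
    (is "\<exists>k\<ge>K. ?B k")
proof (rule ccontr)
  assume "\<not> (\<exists>k\<ge>K. ?B k)"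
  \<comment> \<open>Failure of the bound is assumed only from an arbitrary \<open>K\<close> on, so
    its refutation gives arbitrarily large \<open>k\<close>; the second part of the theorem relies
    on this.\<close>
  then have contra: "\<not> ?B k" if "K \<le> k" for k using that by blast
  obtain F where F: "\<And>k. F \<le> barf M c (itx it k) (its it k)"
    using barf_bounded_below by blast
  define p where "p k = merit M c (itx it k) (its it k) (mpar st k) - mpar st k * F" for k
  have p_nonneg: "0 \<le> p k" for k
    using mult_left_mono[OF F[of k] tau_nonneg(1)[of k]] by (simp add: p_def merit_def add_increasing2)
  have p_step: "p (Suc k) \<le> p k - eps_c c" if "K \<le> k" for k
  proof -
    have dec: "merit M c (itx it (Suc k)) (its it (Suc k)) (mpar st k)
        \<le> merit M c (itx it k) (its it k) (mpar st k) - (2 + zeta c) * eps_k c st k"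
      using contra[OF that] by (intro merit_decrease) (simp_all add: not_le)
    have "mpar st (Suc k) * (barf M c (itx it (Suc k)) (its it (Suc k)) - F)
        \<le> mpar st k * (barf M c (itx it (Suc k)) (its it (Suc k)) - F)"
      using mpar_antimono[OF valid noisy, of k] F[of "Suc k"] by (intro mult_right_mono) auto
    \<comment> \<open>This makes the decrease uniform in \<open>k\<close>, although
      \<open>eps_k\<close> varies with the merit parameter.\<close>
    moreover have "1 * eps_c c \<le> (2 + zeta c) * eps_k c st k"
      using par eps_k_ge[of k] by (intro mult_mono) auto
    ultimately show ?thesis using dec by (simp add: p_def merit_def right_diff_distrib)
  qed
  have "p (K + n) \<le> p K - n * eps_c c" for n
  proof (induction n)
    case (Suc n)
    then show ?case using p_step[of "K + n"] by (simp add: algebra_simps)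
  qed simp
  moreover obtain n :: nat where "p K < n * eps_c c"
    using reals_Archimedean3[OF par(9)] by blast
  ultimately show False using p_nonneg[of "K + n"] by (smt (verit))
qed

section \<open>Noise-level bounds\<close>

text \<open>The barrier block of the gradient is exact and cancels.\<close>

lemma gk_noise: "norm (gk M c it k - gk N c it k) \<le> eps_g c"
  using noise_bounds(2)[OF itx_X[of k]]
  by (simp add: gk_def barg_def stack_diff norm_stack_0 norm_minus_commute)

lemma ck_noise: "norm (ck M it k - ck N it k) \<le> eps_c c"
  using noise_bounds(3)[OF itx_X[of k]] by (simp add: ck_def barc_def norm_minus_commute)

lemma Jk_noise: "norm ((Jk M it k - Jk N it k) *v p) \<le> eps_J c * norm p"
proof -
  have "norm ((Jk M it k - Jk N it k) *v p) = norm ((Jk N it k - Jk M it k) *v p)"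
    by (simp add: matrix_vector_mult_diff_rdistrib norm_minus_commute)
  also have "\<dots> \<le> spec_norm (jac N (itx it k) - jac M (itx it k)) * norm p"
    unfolding Jk_def barJ_def by (rule spec_norm_beside_diff)
  also have "\<dots> \<le> eps_J c * norm p"
    using noise_bounds(4)[OF itx_X[of k]] by (intro mult_right_mono) auto
  finally show ?thesis .
qed

lemma norm_dir_le:
  assumes "norm (dir st k - dir sb k) \<le> e"
  shows "norm (dir st k) \<le> norm (dir sb k) + e"
  using assms norm_triangle_ineq[of "dir sb k" "dir st k - dir sb k"] by simp

text \<open>By \<open>delta_m_data\<close> the error compares two reductions along the same
  direction. Gradient and Jacobian noise contribute multiples of \<open>norm (dir st k)\<close>, and
  constraint noise enters twice. Bounding that norm by \<open>norm (dir sb k) + e\<close> separates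
  the two constants.\<close>

lemma E_m1_bound:
  assumes "norm (dir st k - dir sb k) \<le> e"
  shows "\<bar>E_m1 M N c it st sb k\<bar> \<le> e1_m1 c e + e2_m1 c * norm (dir sb k)"
proof -
  let ?g = "(gk M c it k - gk N c it k) \<bullet> dir st k"
  let ?d = "dir st k" and ?cM = "ck M it k" and ?cN = "ck N it k"
  have eq: "E_m1 M N c it st sb k = - (mpar st k * ?g) + (norm ?cM - norm ?cN)
      - (norm (?cM + Jk M it k *v ?d) - norm (?cN + Jk N it k *v ?d))"
    using delta_m_data[of k] by (simp add: delta_m_def inner_diff_left algebra_simps)
  have "\<bar>?g\<bar> \<le> eps_g c * norm ?d"
    using Cauchy_Schwarz_ineq2[of "gk M c it k - gk N c it k" ?d]
      mult_right_mono[OF gk_noise[of k] norm_ge_zero[of ?d]] by linarith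
  then have "\<bar>mpar st k * ?g\<bar> \<le> tau_init c * (eps_g c * norm ?d)"
    using tau_nonneg(1)[of k] tau_le_init(1)[of k] unfolding abs_mult by (intro mult_mono) auto
  moreover have "\<bar>norm ?cM - norm ?cN\<bar> \<le> eps_c c"
    using norm_triangle_ineq3[of ?cM ?cN] ck_noise[of k] by linarith
  moreover have "\<bar>norm (?cM + Jk M it k *v ?d) - norm (?cN + Jk N it k *v ?d)\<bar>
      \<le> eps_c c + eps_J c * norm ?d"
  proof -
    have diff: "(?cM + Jk M it k *v ?d) - (?cN + Jk N it k *v ?d)
        = (?cM - ?cN) + (Jk M it k - Jk N it k) *v ?d"
      by (simp add: matrix_vector_mult_diff_rdistrib)
    then show ?thesis
      using norm_triangle_ineq3[of "?cM + Jk M it k *v ?d" "?cN + Jk N it k *v ?d", unfolded diff]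
        norm_triangle_ineq[of "?cM - ?cN" "(Jk M it k - Jk N it k) *v ?d"]
        ck_noise[of k] Jk_noise[of k ?d] by linarith
  qed
  ultimately have "\<bar>E_m1 M N c it st sb k\<bar> \<le> (tau_init c * eps_g c + eps_J c) * norm ?d + 2 * eps_c c"
    unfolding eq by (simp add: algebra_simps)
  also have "\<dots> \<le> (tau_init c * eps_g c + eps_J c) * (norm (dir sb k) + e) + 2 * eps_c c"
    using norm_dir_le[OF assms] par by (intro add_right_mono mult_left_mono) auto
  finally show ?thesis by (simp add: e1_m1_def e2_m1_def algebra_simps)
qed

lemma E_m2_bound:
  assumes e: "norm (dir st k - dir sb k) \<le> e"
    and g: "norm (gk N c it k) \<le> g_sup" and J: "spec_norm (Jk N it k) \<le> J_sup"
  shows "\<bar>E_m2 N c it st sb k\<bar> \<le> c1_m2 c g_sup J_sup e + c2_m2 c g_sup * norm (dir sb k)"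
proof -
  let ?g = "gk N c it k" and ?d = "dir st k" and ?b = "dir sb k" and ?c = "ck N it k"
  let ?J = "Jk N it k"
  \<comment> \<open>The terms are grouped so that the direction error is paired with
    \<open>mpar st k\<close> and the parameter error with the exact direction. Both parameters lie
    between 0 and \<open>tau_init c\<close>, so their difference is at most
    \<open>tau_init c\<close>.\<close>
  have eq: "E_m2 N c it st sb k
      = - (mpar st k * (?g \<bullet> (?d - ?b))) - (mpar st k - mpar sb k) * (?g \<bullet> ?b)
        + (norm (?c + ?J *v ?b) - norm (?c + ?J *v ?d))"
    using delta_m_mixed[of k] by (simp add: delta_m_def inner_diff_right algebra_simps)
  have inner: "\<bar>?g \<bullet> p\<bar> \<le> g_sup * norm p" for p
    using Cauchy_Schwarz_ineq2[of ?g p] mult_right_mono[OF g norm_ge_zero[of p]] by linarith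
  have g0: "0 \<le> g_sup" using g norm_ge_zero[of ?g] by linarith
  have "\<bar>mpar st k * (?g \<bullet> (?d - ?b))\<bar> \<le> tau_init c * (g_sup * e)"
    using tau_nonneg(1)[of k] tau_le_init(1)[of k] order_trans[OF inner mult_left_mono[OF e g0]]
    unfolding abs_mult by (intro mult_mono) auto
  moreover have "\<bar>(mpar st k - mpar sb k) * (?g \<bullet> ?b)\<bar> \<le> tau_init c * (g_sup * norm ?b)"
    using tau_nonneg[of k] tau_le_init[of k] inner[of ?b] unfolding abs_mult
    by (intro mult_mono) auto
  moreover have "\<bar>norm (?c + ?J *v ?b) - norm (?c + ?J *v ?d)\<bar> \<le> J_sup * e"
  proof -
    have J0: "0 \<le> J_sup"
      using J onorm_pos_le[OF matrix_vector_mul_bounded_linear[of ?J]] by (simp add: spec_norm_def)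
    have "\<bar>norm (?c + ?J *v ?b) - norm (?c + ?J *v ?d)\<bar> \<le> norm (?J *v (?d - ?b))"
      using norm_triangle_ineq3[of "?c + ?J *v ?d" "?c + ?J *v ?b"]
      by (simp add: matrix_vector_mult_diff_distrib abs_minus_commute)
    also have "\<dots> \<le> spec_norm ?J * norm (?d - ?b)" by (rule spec_norm_bound)
    also have "\<dots> \<le> J_sup * e" using J e J0 by (intro mult_mono) auto
    finally show ?thesis .
  qed
  ultimately show ?thesis
    unfolding eq c1_m2_def c2_m2_def by (simp add: algebra_simps)
qed

section \<open>The step size \<open>alpha_bar\<close> and the term \<open>rho3\<close>\<close>

lemma alpha_bar_zero:
  assumes "delta_m N c it k (dir sb k) (mpar sb k) = 0"
  shows "alpha_bar N c Lg LJ it st sb e xd k = 0"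
  using assms amax_bounds(1)[of k]
  by (simp add: alpha_bar_def Let_def min_def flip: zero_ereal_def)

text \<open>Makes the second bound trivial when the noiseless reduction vanishes.\<close>

lemma rho3_infinite:
  assumes "delta_m N c it k (dir sb k) (mpar sb k) = 0"
  shows "rho3 N c Lg LJ it st sb e xd k = \<infinity>"
  using par eps_k_pos[of k] by (simp add: rho3_def alpha_bar_zero[OF assms] ereal_pos_divide_zero)

text \<open>With a positive reduction no denominator vanishes, so the extended-real expressions
  reduce to real ones.\<close>

lemma rho3_real:
  fixes k and xd e :: real
  defines "D \<equiv> delta_m N c it k (dir sb k) (mpar sb k)"
  defines "a \<equiv> (1 - eta_phi c) * xd * D / (4 * xi2 c Lg LJ (mpar st k) * (D + xd * e\<^sup>2))"
  assumes "0 < D" "0 < xd"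
  shows "0 < a"
    and "rho3 N c Lg LJ it st sb e xd k
      = ereal (4 * (4 + 2 * zeta c) * eps_k c st k / (min a (amax it k) * eta_phi c))"
proof -
  define q where "q = 4 * xi2 c Lg LJ (mpar st k) * (D + xd * e\<^sup>2)"
  have q: "0 < q"
    unfolding q_def using assms(3,4) xi2_mpar_pos[of k]
    by (intro mult_pos_pos add_pos_nonneg) auto
  then show "0 < a" using assms(3,4) par by (simp add: a_def flip: q_def)
  then have pos: "0 < min a (amax it k) * eta_phi c" using par amax_bounds[of k] by simp
  have "alpha_bar N c Lg LJ it st sb e xd k
      = min (ereal ((1 - eta_phi c) * xd * D) / ereal q) (ereal (amax it k))"
    by (simp only: alpha_bar_def Let_def D_def q_def)
  then have "alpha_bar N c Lg LJ it st sb e xd k = ereal (min a (amax it k))"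
    using q by (simp add: a_def min_def flip: q_def)
  then show "rho3 N c Lg LJ it st sb e xd k
      = ereal (4 * (4 + 2 * zeta c) * eps_k c st k / (min a (amax it k) * eta_phi c))"
    using pos unfolding rho3_def by (auto simp: min_def split: if_splits)
qed

text \<open>Taking reciprocals turns the minimum in \<open>alpha_bar\<close> into a maximum. The
  premise \<open>nz\<close> excludes \<open>D = 0\<close> together with \<open>e = 0\<close>, where
  the fraction in \<open>rho3_expanded\<close> would be \<open>0 / 0\<close>.\<close>

lemma rho3_eq_expanded:
  fixes k
  defines "D \<equiv> delta_m N c it k (dir sb k) (mpar sb k)"
  assumes xd: "0 < xd" and nz: "D + xd * e\<^sup>2 \<noteq> 0"
  shows "rho3 N c Lg LJ it st sb e xd k = rho3_expanded c Lg LJ it st e xd D k"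
proof (cases "D = 0")
  case True
  \<comment> \<open>With this positive numerator over a zero denominator, the expanded form is
    infinite like \<open>rho3\<close> itself.\<close>
  have "0 < 4 * xi2 c Lg LJ (mpar st k) * (xd * e\<^sup>2)"
    using nz True xd xi2_mpar_pos[of k] by simp
  then show ?thesis
    using True par eps_k_pos[of k] rho3_infinite[of k e xd]
    by (simp add: rho3_expanded_def D_def ereal_pos_divide_zero max_def flip: zero_ereal_def)
next
  case False
  then have D: "0 < D" using delta_m_exact_nonneg[of k] by (simp add: D_def)
  define a where "a = (1 - eta_phi c) * xd * D / (4 * xi2 c Lg LJ (mpar st k) * (D + xd * e\<^sup>2))"
  note r = rho3_real[where k = k and e = e, folded D_def, OF D xd, folded a_def]
  have inv: "4 * xi2 c Lg LJ (mpar st k) * (D + xd * e\<^sup>2) / ((1 - eta_phi c) * xd * D) = 1 / a"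
    by (simp add: a_def)
  have "1 / min a (amax it k) = max (1 / a) (1 / amax it k)"
    using r(1) amax_bounds(1)[of k] by (simp add: min_def max_def field_simps)
  then have "4 * (4 + 2 * zeta c) * eps_k c st k / (min a (amax it k) * eta_phi c)
      = 4 * (4 + 2 * zeta c) * eps_k c st k / eta_phi c * max (1 / a) (1 / amax it k)"
    by (metis mult.commute times_divide_times_eq mult.right_neutral)
  moreover have "(1 - eta_phi c) * xd * D \<noteq> 0" using D xd par by simp
  ultimately show ?thesis
    unfolding r(2) rho3_expanded_def by (simp add: inv max_def)
qed

text \<open>It amounts to \<open>alpha_bar\<close> being at most \<open>alpha_hat\<close>. The
  estimate \<open>(a + b)^2 \<le> 2 * a^2 + 2 * b^2\<close> and the lower bound on \<open>D\<close>
  give \<open>xd * (norm (dir st k))^2 \<le> 2 * (D + xd * e^2)\<close>, which explains the 4 in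
  \<open>alpha_bar\<close> against the 2 in \<open>alpha_hat\<close>.\<close>

lemma step_bound_le_rho3:
  fixes k
  defines "D \<equiv> delta_m N c it k (dir sb k) (mpar sb k)"
  assumes e: "norm (dir st k - dir sb k) \<le> e"
    and xd: "0 < xd" "xd * (norm (dir sb k))\<^sup>2 \<le> D"
  shows "ereal (4 * (4 + 2 * zeta c) * eps_k c st k)
      / (alpha_hat N c Lg LJ it st sb k * ereal (eta_phi c))
    \<le> rho3 N c Lg LJ it st sb e xd k"
proof (cases "D = 0")
  case True
  then show ?thesis using rho3_infinite[of k] by (simp add: D_def)
next
  case False
  then have D: "0 < D" using delta_m_exact_nonneg[of k] by (simp add: D_def)
  define a where "a = (1 - eta_phi c) * xd * D / (4 * xi2 c Lg LJ (mpar st k) * (D + xd * e\<^sup>2))"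
  note r = rho3_real[where k = k and e = e, folded D_def, OF D xd(1), folded a_def]
  let ?P = "4 * (4 + 2 * zeta c) * eps_k c st k" and ?n = "(norm (dir st k))\<^sup>2"
  let ?q = "2 * xi2 c Lg LJ (mpar st k) * ?n"
  have P: "0 \<le> ?P" using par eps_k_pos[of k] by simp
  have "?n \<le> (norm (dir sb k) + e)\<^sup>2"
    using norm_dir_le[OF e] by (intro power_mono) auto
  also have "\<dots> \<le> 2 * (norm (dir sb k))\<^sup>2 + 2 * e\<^sup>2"
    using sum_squares_bound[of "norm (dir sb k)" e] by (simp add: power2_sum)
  finally have "xd * ?n \<le> xd * (2 * (norm (dir sb k))\<^sup>2 + 2 * e\<^sup>2)"
    using xd(1) by (intro mult_left_mono) auto
  then have n: "xd * ?n \<le> 2 * (D + xd * e\<^sup>2)" using xd(2) by (simp add: algebra_simps)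
  have hat: "alpha_hat N c Lg LJ it st sb k
      = min (ereal ((1 - eta_phi c) * D) / ereal ?q) (ereal (amax it k))"
    by (simp add: alpha_hat_def Let_def D_def)
  have A: "0 < (1 - eta_phi c) * D" using D par by simp
  have "ereal (min a (amax it k)) \<le> alpha_hat N c Lg LJ it st sb k"
  proof (cases "dir st k = 0")
    case True
    then show ?thesis using A by (simp add: hat ereal_pos_divide_zero flip: zero_ereal_def)
  next
    case False
    then have q: "0 < ?q" using xi2_mpar_pos[of k] by simp
    have "a = (1 - eta_phi c) * D / (4 * xi2 c Lg LJ (mpar st k) * (D + xd * e\<^sup>2) / xd)"
      by (simp add: a_def)
    also have "\<dots> \<le> (1 - eta_phi c) * D / ?q"
    proof (rule divide_left_mono)
      have "2 * xi2 c Lg LJ (mpar st k) * (xd * ?n)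
          \<le> 2 * xi2 c Lg LJ (mpar st k) * (2 * (D + xd * e\<^sup>2))"
        using n xi2_mpar_pos[of k] by (intro mult_left_mono) auto
      then show "?q \<le> 4 * xi2 c Lg LJ (mpar st k) * (D + xd * e\<^sup>2) / xd"
        using xd(1) by (simp add: pos_le_divide_eq) (simp add: algebra_simps)
      then show "0 < 4 * xi2 c Lg LJ (mpar st k) * (D + xd * e\<^sup>2) / xd * ?q"
        using q by (intro mult_pos_pos[of _ ?q]) linarith+
    qed (use A in simp)
    finally show ?thesis using q by (auto simp: hat min_def)
  qed
  moreover obtain h where h: "alpha_hat N c Lg LJ it st sb k = ereal h" "0 < h"
    using alpha_hat_real[of k] D by (auto simp: D_def)
  ultimately have le: "min a (amax it k) \<le> h" by (simp add: min_def split: if_splits)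
  have "?P / (h * eta_phi c) \<le> ?P / (min a (amax it k) * eta_phi c)"
    using P le r(1) amax_bounds(1)[of k] par h
    by (intro divide_left_mono mult_right_mono mult_pos_pos) auto
  then show ?thesis using h par by (simp add: r(2))
qed

text \<open>Source of the factors \<open>xd powr (- 1/2)\<close> and \<open>D powr (1/2)\<close> in
  \<open>rho1\<close> and \<open>rho2\<close>.\<close>

lemma norm_dir_exact_le:
  assumes "0 < xd" "xd * (norm (dir sb k))\<^sup>2 \<le> D"
  shows "norm (dir sb k) \<le> xd powr (- 1/2) * D powr (1/2)"
proof -
  have "0 \<le> xd * (norm (dir sb k))\<^sup>2" using assms(1) by simp
  then have "0 \<le> D" using assms(2) by linarith
  then have "xd powr (- 1/2) * D powr (1/2) = sqrt (D / xd)"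
    using assms(1) by (simp add: powr_minus_divide powr_half_sqrt real_sqrt_divide)
  moreover have "(norm (dir sb k))\<^sup>2 \<le> D / xd"
    using assms by (simp add: pos_le_divide_eq mult.commute)
  ultimately show ?thesis by (simp add: real_le_rsqrt)
qed

text \<open>The three terms of the maximum are bounded one by one. The error bounds are affine in
  \<open>norm (dir sb k)\<close> with nonnegative slope, so this norm may be replaced by its upper
  bound \<open>w\<close>.\<close>

lemma rho_bound:
  fixes k
  defines "D \<equiv> delta_m N c it k (dir sb k) (mpar sb k)"
  assumes bound: "ereal D
      \<le> Max {ereal (2 * (eta_phi c * E_m1 M N c it st sb k
                           - (1 - eta_phi c) * E_m2 N c it st sb k) / (1 - eta_phi c)),
              ereal (- 2 * E_m M N c it st sb k),
              ereal (4 * (4 + 2 * zeta c) * eps_k c st k)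
                / (alpha_hat N c Lg LJ it st sb k * ereal (eta_phi c))}"
    and g: "norm (gk N c it k) \<le> g_sup" and J: "spec_norm (Jk N it k) \<le> J_sup"
    and e: "norm (dir st k - dir sb k) \<le> e"
    and xd: "0 < xd" "xd * (norm (dir sb k))\<^sup>2 \<le> D"
  shows "ereal D \<le> Max {ereal (rho1 c g_sup J_sup e xd D), ereal (rho2 c g_sup J_sup e xd D),
      rho3 N c Lg LJ it st sb e xd k}"
proof -
  let ?E1 = "E_m1 M N c it st sb k" and ?E2 = "E_m2 N c it st sb k"
  define \<theta> where "\<theta> = eta_phi c / (1 - eta_phi c)"
  define w where "w = xd powr (- 1/2) * D powr (1/2)"
  have \<theta>: "0 \<le> \<theta>" using par by (simp add: \<theta>_def)
  have g0: "0 \<le> g_sup" using g norm_ge_zero[of "gk N c it k"] by linarith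
  have nw: "norm (dir sb k) \<le> w"
    unfolding w_def by (rule norm_dir_exact_le[OF xd])
  have "e2_m1 c * norm (dir sb k) \<le> e2_m1 c * w"
    using nw par by (intro mult_left_mono) (auto simp: e2_m1_def)
  then have E1: "\<bar>?E1\<bar> \<le> e1_m1 c e + e2_m1 c * w"
    using E_m1_bound[OF e] by linarith
  have "c2_m2 c g_sup * norm (dir sb k) \<le> c2_m2 c g_sup * w"
    using nw par g0 by (intro mult_left_mono) (auto simp: c2_m2_def)
  then have E2: "\<bar>?E2\<bar> \<le> c1_m2 c g_sup J_sup e + c2_m2 c g_sup * w"
    using E_m2_bound[OF e g J] by linarith
  have "2 * (eta_phi c * ?E1 - (1 - eta_phi c) * ?E2) / (1 - eta_phi c) = 2 * (\<theta> * ?E1 - ?E2)"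
    using par by (simp add: \<theta>_def field_simps)
  also have "\<dots> \<le> 2 * (\<theta> * (e1_m1 c e + e2_m1 c * w) + (c1_m2 c g_sup J_sup e + c2_m2 c g_sup * w))"
    using mult_left_mono[of ?E1 "e1_m1 c e + e2_m1 c * w" \<theta>] \<theta> E1 E2 by (simp add: abs_le_iff)
  also have "\<dots> = rho1 c g_sup J_sup e xd D"
    unfolding rho1_def \<theta>_def[symmetric] w_def by (simp add: algebra_simps)
  finally have b1: "2 * (eta_phi c * ?E1 - (1 - eta_phi c) * ?E2) / (1 - eta_phi c)
      \<le> rho1 c g_sup J_sup e xd D" .
  have "- 2 * E_m M N c it st sb k
      \<le> 2 * ((e1_m1 c e + e2_m1 c * w) + (c1_m2 c g_sup J_sup e + c2_m2 c g_sup * w))"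
    using E1 E2 by (simp add: E_m_def abs_le_iff)
  also have "\<dots> = rho2 c g_sup J_sup e xd D"
    unfolding rho2_def w_def by (simp add: algebra_simps)
  finally have b2: "- 2 * E_m M N c it st sb k \<le> rho2 c g_sup J_sup e xd D" .
  have b3: "ereal (4 * (4 + 2 * zeta c) * eps_k c st k)
      / (alpha_hat N c Lg LJ it st sb k * ereal (eta_phi c)) \<le> rho3 N c Lg LJ it st sb e xd k"
    by (rule step_bound_le_rho3[OF e xd[unfolded D_def]])
  have mono: "Max {a1, a2, a3} \<le> Max {r1, r2, r3}"
    if "a1 \<le> r1" "a2 \<le> r2" "a3 \<le> r3" for a1 a2 a3 r1 r2 r3 :: ereal
    using that by (auto intro: max.coboundedI1 max.coboundedI2)
  show ?thesis
    using b1 b2 b3 by (intro order_trans[OF bound] mono) simp_all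
qed

end

theorem theorem1:
  fixes M N :: "('n::finite, 'q::finite) model"
    and c :: params
    and it :: "('n, 'q) iterates"
    and st sb :: "('n, 'q) steps"
    and X :: "(real^'n) set"
    and Lg LJ :: real
  assumes run: "infinite_run M c it st"
    and noiseless: "steps_from N c it sb"
    and noise: "noise_assumption M N c it st X Lg LJ"
    and matrix: "matrix_assumption M N c it st sb"
    and slack: "slack_assumption it"
  shows
    "(\<exists>k. ereal (delta_m N c it k (dir sb k) (mpar sb k))
        \<le> Max {ereal (2 * (eta_phi c * E_m1 M N c it st sb k
                             - (1 - eta_phi c) * E_m2 N c it st sb k) / (1 - eta_phi c)),
                ereal (- 2 * E_m M N c it st sb k),
                ereal (4 * (4 + 2 * zeta c) * eps_k c st k)
                  / (alpha_hat N c Lg LJ it st sb k * ereal (eta_phi c))})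
     \<and>
     (\<forall>kJ \<gamma> l sG g_sup J_sup ktau taubar ed xd.
        rank_assumption M c it kJ \<gamma> \<longrightarrow>
        jacobian_noise_assumption M N c it kJ l sG \<longrightarrow>
        0 < g_sup \<and> (\<forall>k. norm (gk N c it k) \<le> g_sup) \<longrightarrow>
        0 < J_sup \<and> (\<forall>k. spec_norm (Jk N it k) \<le> J_sup) \<longrightarrow>
        0 < taubar \<and> (\<forall>k\<ge>ktau. mpar sb k = taubar) \<longrightarrow>
        0 \<le> ed \<and> (\<forall>k\<ge>kJ. norm (dir st k - dir sb k) \<le> ed) \<longrightarrow>
        0 < xd \<and> (\<forall>k. xd * (norm (dir sb k))^2 \<le> delta_m N c it k (dir sb k) (mpar sb k)) \<longrightarrow>
        (\<exists>k\<ge>ktau. let D = delta_m N c it k (dir sb k) taubar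
           in ereal D \<le> Max {ereal (rho1 c g_sup J_sup ed xd D),
                              ereal (rho2 c g_sup J_sup ed xd D),
                              rho3 N c Lg LJ it st sb ed xd k})
        \<and> (\<forall>k\<ge>ktau. let D = delta_m N c it k (dir sb k) taubar
             in D + xd * ed^2 \<noteq> 0 \<longrightarrow>
                rho3 N c Lg LJ it st sb ed xd k = rho3_expanded c Lg LJ it st ed xd D k))"
proof -
  interpret noisy_run M N c it st sb X Lg LJ
    using run noiseless noise matrix slack by unfold_locales
  show ?thesis
  proof (intro conjI allI impI, goal_cases)
    case 1
    show ?case using model_reduction_bound_frequently[of 0] by blast
  next
    case (2 kJ \<gamma> l sG g_sup J_sup ktau taubar ed xd)
    \<comment> \<open>From \<open>ktau\<close> on the noiseless merit parameter is
      \<open>taubar\<close>, and from \<open>kJ\<close> on the direction error is at most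
      \<open>ed\<close>; both are needed at the chosen index.\<close>
    obtain k where k: "max ktau kJ \<le> k" and bound: "ereal (delta_m N c it k (dir sb k) (mpar sb k))
      \<le> Max {ereal (2 * (eta_phi c * E_m1 M N c it st sb k
                           - (1 - eta_phi c) * E_m2 N c it st sb k) / (1 - eta_phi c)),
              ereal (- 2 * E_m M N c it st sb k),
              ereal (4 * (4 + 2 * zeta c) * eps_k c st k)
                / (alpha_hat N c Lg LJ it st sb k * ereal (eta_phi c))}"
      using model_reduction_bound_frequently by blast
    have "mpar sb k = taubar" using 2(5) k by simp
    then show ?case
      using rho_bound[OF bound, of g_sup J_sup ed xd] 2 k unfolding Let_def
      by (intro exI[of _ k]) auto
  next
    case (3 kJ \<gamma> l sG g_sup J_sup ktau taubar ed xd k)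
    then show ?case using rho3_eq_expanded[of xd k ed] by (auto simp: Let_def)
  qed
qed

end
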